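(* Let $\varphi$ be a continuous random dynamical system on the Polish space $E$ (equipped with the metric $d$) over the metric dynamical system $(\Omega,\mathscr F,P,(\vartheta_t)_{t\in\mathbb R})$. The following are equivalent: (i) $\varphi$ has a weak $C$-attractor. (ii) For every $\varepsilon>0$ there exists a compact subset $C_\varepsilon\subset E$ such that for each $\delta>0$ and each compact subset $C$ of $E$ there is a $t_0>0$ with the property that for all $t\ge t_0$, $$P\bigl\{\varphi(t,\omega)(C)\subset C_\varepsilon^\delta\bigr\}\ge 1-\varepsilon .$$ (iii) There exists a compact weakly $C$-attracting set $\omega\mapsto K(\omega)$, i.e. a compact random set $K$ which weakly attracts every compact subset of $E$.
   Context: $E$ is a Polish space with Borel $\sigma$-algebra $\mathscr B$, equipped with a complete metric $d$ inducing its topology. For $x\in E$, $A\subset E$: $d(x,A)=\inf_{a\in A}d(x,a)$; for non-empty sets, $d(B,A)=\sup_{b\in B}d(b,A)$. For $A\subset E$ and $\delta>0$, $A^\delta$ is the closed $\delta$-neighbourhood of $A$. A metric dynamical system $(\Omega,\mathscr F,P,(\vartheta_t)_{t\in\mathbb R})$ is a probability space with maps $\vartheta_t:\Omega\to\Omega$ such that $(\omega,t)\mapsto\vartheta_t\omega$ is $(\mathscr F\otimes\mathscr B(\mathbb R),\mathscr F)$-measurable, $\vartheta_{s+t}=\vartheta_s\circ\vartheta_t$, $\vartheta_0=\mathrm{Id}_\Omega$, and each $\vartheta_t$ preserves $P$. A random dynamical system (RDS) is a $(\mathscr B([0,\infty))\otimes\mathscr B\otimes\mathscr F,\mathscr B)$-measurable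 map $\varphi:[0,\infty)\times E\times\Omega\to E$, $(t,x,\omega)\mapsto\varphi(t,x,\omega)=\varphi(t,\omega)(x)$, with $\varphi(0,\omega)=\mathrm{Id}_E$ and $\varphi(t+s,\omega)=\varphi(t,\vartheta_s\omega)\circ\varphi(s,\omega)$ for all $s,t\ge0$, $\omega\in\Omega$. It is continuous if $x\mapsto\varphi(t,x,\omega)$ is continuous for all $(t,\omega)$; no continuity in $t$ is assumed. A compact random set is a map $\omega\mapsto A(\omega)$ with values in the compact subsets of $E$ such that $\omega\mapsto d(x,A(\omega))$ is measurable for every $x\in E$; random sets are assumed non-empty almost surely. A compact random set $K$ weakly attracts a (deterministic) set $B\subset E$ if $d(\varphi(t,\vartheta_{-t}\omega)B,K(\omega))\to0$ in probability as $t\to\infty$. A weak $C$-attractor is a compact random set $A$ such that (a) $A$ is strictly $\varphi$-invariant: for each $t\ge0$ there is a set $\Omega_t$ of full measure with $\varphi(t,\omega)(A(\omega))=A(\vartheta_t\omega)$ for all $\omega\in\Omega_t$; and (b) for every compact $B\subset E$, $\lim_{t\to\infty}\sup_{x\in B}d(\varphi(t,\omega)(x),A(\vartheta_t\omega))=0$ in probability. *)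

theory Defs
  imports "HOL-Probability.Probability"
begin

text \<open>
  The state space is a type of class \<open>polish_space\<close>; its \<open>dist\<close> is the complete metric \<open>d\<close>.

  Distances to a set are taken in \<open>ennreal\<close>, so that the distance to the empty set is infinite.
  With \<open>infdist\<close> it would be \<open>0\<close>, and every neighbourhood of the empty set would be
  the whole space.
\<close>

definition pt_dist :: "'e::metric_space \<Rightarrow> 'e set \<Rightarrow> ennreal" where
  "pt_dist x A = (INF a\<in>A. ennreal (dist x a))"

definition semi_dist :: "'e::metric_space set \<Rightarrow> 'e set \<Rightarrow> ennreal" where
  "semi_dist B A = (SUP b\<in>B. pt_dist b A)"

definition closed_nbhd :: "'e::metric_space set \<Rightarrow> real \<Rightarrow> 'e set" where
  "closed_nbhd A \<delta> = {x. pt_dist x A \<le> ennreal \<delta>}"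

locale metric_dynamical_system = prob_space P for P :: "'w measure" +
  fixes \<theta> :: "real \<Rightarrow> 'w \<Rightarrow> 'w"
  assumes measurable_shift: "(\<lambda>(\<omega>, t). \<theta> t \<omega>) \<in> P \<Otimes>\<^sub>M borel \<rightarrow>\<^sub>M P"
    and shift_add: "\<And>s t \<omega>. \<omega> \<in> space P \<Longrightarrow> \<theta> (s + t) \<omega> = \<theta> s (\<theta> t \<omega>)"
    and shift_zero: "\<And>\<omega>. \<omega> \<in> space P \<Longrightarrow> \<theta> 0 \<omega> = \<omega>"
    and shift_preserves: "\<And>t. distr P P (\<theta> t) = P"

text \<open>
  Time is \<open>[0,\<infinity>)\<close>: values of \<open>\<phi>\<close> at negative times are unconstrained and never used.
\<close>

locale random_dynamical_system = metric_dynamical_system P \<theta>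
  for P :: "'w measure" and \<theta> :: "real \<Rightarrow> 'w \<Rightarrow> 'w" +
  fixes \<phi> :: "real \<Rightarrow> 'w \<Rightarrow> 'e::polish_space \<Rightarrow> 'e"
  assumes measurable_flow:
      "(\<lambda>(t, x, \<omega>). \<phi> t \<omega> x) \<in> restrict_space borel {0..} \<Otimes>\<^sub>M borel \<Otimes>\<^sub>M P \<rightarrow>\<^sub>M borel"
    and flow_zero: "\<And>\<omega> x. \<omega> \<in> space P \<Longrightarrow> \<phi> 0 \<omega> x = x"
    and cocycle: "\<And>s t \<omega> x. 0 \<le> s \<Longrightarrow> 0 \<le> t \<Longrightarrow> \<omega> \<in> space P \<Longrightarrow>
                    \<phi> (t + s) \<omega> x = \<phi> t (\<theta> s \<omega>) (\<phi> s \<omega> x)"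

locale continuous_random_dynamical_system = random_dynamical_system P \<theta> \<phi>
  for P :: "'w measure" and \<theta> :: "real \<Rightarrow> 'w \<Rightarrow> 'w"
    and \<phi> :: "real \<Rightarrow> 'w \<Rightarrow> 'e::polish_space \<Rightarrow> 'e" +
  assumes continuous_flow: "\<And>t \<omega>. 0 \<le> t \<Longrightarrow> \<omega> \<in> space P \<Longrightarrow> continuous_on UNIV (\<phi> t \<omega>)"

definition compact_random_set :: "'w measure \<Rightarrow> ('w \<Rightarrow> 'e::metric_space set) \<Rightarrow> bool" where
  "compact_random_set P A \<longleftrightarrow>
     (\<forall>\<omega>\<in>space P. compact (A \<omega>)) \<and>
     (\<forall>x. (\<lambda>\<omega>. pt_dist x (A \<omega>)) \<in> borel_measurable P) \<and>
     (AE \<omega> in P. A \<omega> \<noteq> {})"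

text \<open>
  Convergence to \<open>0\<close> in probability as \<open>t \<rightarrow> \<infinity>\<close>. Measurability is not part of the definition;
  the families to which it is applied below are measurable by
  \<open>measurable_SUP_pt_dist_flow\<close>.
\<close>

definition tendsto_zero_in_prob :: "'w measure \<Rightarrow> (real \<Rightarrow> 'w \<Rightarrow> ennreal) \<Rightarrow> bool" where
  "tendsto_zero_in_prob P X \<longleftrightarrow>
     (\<forall>\<epsilon>>0. ((\<lambda>t. \<P>(\<omega> in P. X t \<omega> > ennreal \<epsilon>)) \<longlongrightarrow> 0) at_top)"

definition weakly_attracts ::
  "'w measure \<Rightarrow> (real \<Rightarrow> 'w \<Rightarrow> 'w) \<Rightarrow> (real \<Rightarrow> 'w \<Rightarrow> 'e \<Rightarrow> 'e) \<Rightarrow>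
   ('w \<Rightarrow> 'e::metric_space set) \<Rightarrow> 'e set \<Rightarrow> bool" where
  "weakly_attracts P \<theta> \<phi> K B \<longleftrightarrow>
     tendsto_zero_in_prob P (\<lambda>t \<omega>. semi_dist (\<phi> t (\<theta> (- t) \<omega>) ` B) (K \<omega>))"

definition strictly_invariant ::
  "'w measure \<Rightarrow> (real \<Rightarrow> 'w \<Rightarrow> 'w) \<Rightarrow> (real \<Rightarrow> 'w \<Rightarrow> 'e \<Rightarrow> 'e) \<Rightarrow> ('w \<Rightarrow> 'e set) \<Rightarrow> bool" where
  "strictly_invariant P \<theta> \<phi> A \<longleftrightarrow> (\<forall>t\<ge>0. AE \<omega> in P. \<phi> t \<omega> ` A \<omega> = A (\<theta> t \<omega>))"

definition weak_C_attractor ::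
  "'w measure \<Rightarrow> (real \<Rightarrow> 'w \<Rightarrow> 'w) \<Rightarrow> (real \<Rightarrow> 'w \<Rightarrow> 'e \<Rightarrow> 'e) \<Rightarrow>
   ('w \<Rightarrow> 'e::metric_space set) \<Rightarrow> bool" where
  "weak_C_attractor P \<theta> \<phi> A \<longleftrightarrow>
     compact_random_set P A \<and>
     strictly_invariant P \<theta> \<phi> A \<and>
     (\<forall>B. compact B \<longrightarrow>
        tendsto_zero_in_prob P (\<lambda>t \<omega>. SUP x\<in>B. pt_dist (\<phi> t \<omega> x) (A (\<theta> t \<omega>))))"


subsection \<open>Measurability of the events involved\<close>

lemma pt_dist_infdist: "pt_dist x A = (if A = {} then \<infinity> else ennreal (infdist x A))"
proof (cases "A = {}")
  case True
  then show ?thesis by (simp add: pt_dist_def)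
next
  case False
  have "ennreal (infdist x A) \<le> pt_dist x A"
    unfolding pt_dist_def by (intro INF_greatest ennreal_leI infdist_le)
  moreover have "pt_dist x A \<le> ennreal (infdist x A)"
  proof (rule ennreal_le_epsilon)
    fix e :: real assume "0 < e"
    with False obtain a where a: "a \<in> A" "dist x a < infdist x A + e"
      using cINF_less_iff[of A "dist x" "infdist x A + e"]
      by (auto simp: infdist_notempty intro: bdd_belowI2[of _ 0])
    have "pt_dist x A \<le> ennreal (dist x a)"
      unfolding pt_dist_def using a(1) by (rule INF_lower)
    also have "\<dots> \<le> ennreal (infdist x A + e)"
      using a(2) by (intro ennreal_leI) simp
    also have "\<dots> = ennreal (infdist x A) + ennreal e"
      using \<open>0 < e\<close> by (simp add: infdist_nonneg)
    finally show "pt_dist x A \<le> ennreal (infdist x A) + ennreal e" .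
  qed
  ultimately show ?thesis using False by simp
qed

lemma continuous_pt_dist: "continuous_on UNIV (\<lambda>x. pt_dist x A)"
  by (cases "A = {}")
    (auto simp: pt_dist_infdist intro!: continuous_on_ennreal continuous_on_infdist continuous_on_id)

lemma pt_dist_triangle: "pt_dist x A \<le> pt_dist y A + ennreal (dist y x)"
proof (cases "A = {}")
  case False
  then show ?thesis
    using infdist_triangle[of x A y]
    by (simp add: pt_dist_infdist infdist_nonneg dist_commute flip: ennreal_plus)
qed (simp add: pt_dist_infdist)

lemma measurable_pt_dist_random_set:
  fixes A :: "'w \<Rightarrow> 'e::polish_space set"
  assumes A: "\<And>x. (\<lambda>\<omega>. pt_dist x (A \<omega>)) \<in> borel_measurable P"
    and g: "g \<in> borel_measurable P"
  shows "(\<lambda>\<omega>. pt_dist (g \<omega>) (A \<omega>)) \<in> borel_measurable P"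
proof -
  obtain D :: "'e set" where D: "countable D" "\<And>X. open X \<Longrightarrow> X \<noteq> {} \<Longrightarrow> \<exists>d\<in>D. d \<in> X"
    using countable_dense_exists by blast
  have eq: "pt_dist y B = (INF q\<in>D. pt_dist q B + ennreal (dist q y))" for y :: 'e and B
  proof (rule antisym)
    show "pt_dist y B \<le> (INF q\<in>D. pt_dist q B + ennreal (dist q y))"
      by (intro INF_greatest pt_dist_triangle)
    show "(INF q\<in>D. pt_dist q B + ennreal (dist q y)) \<le> pt_dist y B"
    proof (rule ennreal_le_epsilon)
      fix e :: real assume "0 < e"
      then obtain q where q: "q \<in> D" "dist y q < e / 2"
        using D(2)[of "ball y (e / 2)"] by auto
      have "(INF q\<in>D. pt_dist q B + ennreal (dist q y)) \<le> pt_dist q B + ennreal (dist q y)"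
        using q(1) by (rule INF_lower)
      also have "\<dots> \<le> (pt_dist y B + ennreal (e / 2)) + ennreal (e / 2)"
        using q(2) pt_dist_triangle[of q B y]
        by (intro add_mono order_trans[OF pt_dist_triangle[of q B y]] ennreal_leI)
          (auto simp: dist_commute)
      also have "\<dots> = pt_dist y B + ennreal e"
        using \<open>0 < e\<close> by (simp add: add.assoc flip: ennreal_plus)
      finally show "(INF q\<in>D. pt_dist q B + ennreal (dist q y)) \<le> pt_dist y B + ennreal e" .
    qed
  qed
  have "(\<lambda>\<omega>. INF q\<in>D. pt_dist q (A \<omega>) + ennreal (dist q (g \<omega>))) \<in> borel_measurable P"
  proof (rule borel_measurable_INF[OF D(1)])
    have "(\<lambda>\<omega>. ennreal (dist q (g \<omega>))) \<in> borel_measurable P" for q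
      using g by (intro measurable_compose[OF _ measurable_ennreal] borel_measurable_dist) simp_all
    then show "(\<lambda>\<omega>. pt_dist q (A \<omega>) + ennreal (dist q (g \<omega>))) \<in> borel_measurable P" for q
      by (rule borel_measurable_add[OF A])
  qed
  then show ?thesis by (subst eq)
qed

context continuous_random_dynamical_system
begin

lemma measurable_shift_time [measurable]: "\<theta> t \<in> P \<rightarrow>\<^sub>M P"
proof -
  have "(\<lambda>\<omega>. (\<omega>, t)) \<in> P \<rightarrow>\<^sub>M P \<Otimes>\<^sub>M borel"
    by (rule measurable_Pair2') simp
  from measurable_compose[OF this measurable_shift] show ?thesis by simp
qed

lemma measurable_flow_point:
  assumes "0 \<le> t"
  shows "(\<lambda>\<omega>. \<phi> t \<omega> x) \<in> borel_measurable P"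
proof -
  have "(\<lambda>\<omega>. (t, x, \<omega>)) \<in> P \<rightarrow>\<^sub>M restrict_space borel {0..} \<Otimes>\<^sub>M borel \<Otimes>\<^sub>M P"
    using assms by (intro measurable_Pair measurable_const measurable_ident_sets)
      (auto simp: space_restrict_space)
  from measurable_compose[OF this measurable_flow] show ?thesis by simp
qed

text \<open>With \<open>r = 0\<close>, \<open>s = t\<close> this covers \<open>weak_C_attractor\<close>; with \<open>r = -t\<close>, \<open>s = 0\<close> it covers
  \<open>weakly_attracts\<close>.\<close>

lemma measurable_SUP_pt_dist_flow:
  assumes "compact_random_set P A" "0 \<le> t"
  shows "(\<lambda>\<omega>. SUP x\<in>B. pt_dist (\<phi> t (\<theta> r \<omega>) x) (A (\<theta> s \<omega>))) \<in> borel_measurable P"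
proof -
  obtain D where D: "countable D" "D \<subseteq> B" "B \<subseteq> closure D"
    using separable by blast
  have "(SUP x\<in>B. pt_dist (\<phi> t (\<theta> r \<omega>) x) (A (\<theta> s \<omega>))) =
        (SUP x\<in>D. pt_dist (\<phi> t (\<theta> r \<omega>) x) (A (\<theta> s \<omega>)))" (is "?l = ?r") if "\<omega> \<in> space P" for \<omega>
  proof (rule antisym)
    have "\<theta> r \<omega> \<in> space P"
      using that measurable_space[OF measurable_shift_time] by blast
    then have "continuous_on UNIV (\<lambda>x. pt_dist (\<phi> t (\<theta> r \<omega>) x) (A (\<theta> s \<omega>)))"
      using continuous_flow assms(2)
      by (intro continuous_on_compose2[OF continuous_pt_dist[of "A (\<theta> s \<omega>)"]]) auto
    then have "closed {x. pt_dist (\<phi> t (\<theta> r \<omega>) x) (A (\<theta> s \<omega>)) \<le> ?r}"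
      by (intro closed_Collect_le continuous_on_const)
    then have "closure D \<subseteq> {x. pt_dist (\<phi> t (\<theta> r \<omega>) x) (A (\<theta> s \<omega>)) \<le> ?r}"
      by (intro closure_minimal) (auto intro: SUP_upper)
    with D(3) show "?l \<le> ?r" by (auto intro!: SUP_least)
    show "?r \<le> ?l" using D(2) by (rule SUP_subset_mono) simp
  qed
  moreover have "(\<lambda>\<omega>. SUP x\<in>D. pt_dist (\<phi> t (\<theta> r \<omega>) x) (A (\<theta> s \<omega>))) \<in> borel_measurable P"
  proof (rule borel_measurable_SUP[OF D(1)])
    have A: "(\<lambda>\<omega>. pt_dist x (A (\<theta> s \<omega>))) \<in> borel_measurable P" for x
      using assms(1) unfolding compact_random_set_def
      by (intro measurable_compose[OF measurable_shift_time, where g = "\<lambda>\<omega>. pt_dist x (A \<omega>)"]) simp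
    show "(\<lambda>\<omega>. pt_dist (\<phi> t (\<theta> r \<omega>) x) (A (\<theta> s \<omega>))) \<in> borel_measurable P" for x
      using measurable_compose[OF measurable_shift_time measurable_flow_point[OF assms(2)]]
      by (rule measurable_pt_dist_random_set[OF A])
  qed
  ultimately show ?thesis by (rule measurable_cong[THEN iffD2])
qed

lemma sets_flow_subset_closed_nbhd:
  assumes "0 \<le> t"
  shows "{\<omega> \<in> space P. \<phi> t \<omega> ` C \<subseteq> closed_nbhd S \<delta>} \<in> sets P"
proof -
  obtain D where D: "countable D" "D \<subseteq> C" "C \<subseteq> closure D"
    using separable by blast
  have cl: "closed (closed_nbhd S \<delta>)"
    unfolding closed_nbhd_def by (intro closed_Collect_le continuous_pt_dist continuous_on_const)
  have "\<phi> t \<omega> ` C \<subseteq> closed_nbhd S \<delta> \<longleftrightarrow> (\<forall>x\<in>D. \<phi> t \<omega> x \<in> closed_nbhd S \<delta>)"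
    if "\<omega> \<in> space P" for \<omega>
  proof
    assume "\<forall>x\<in>D. \<phi> t \<omega> x \<in> closed_nbhd S \<delta>"
    moreover have "closed (\<phi> t \<omega> -` closed_nbhd S \<delta>)"
      using continuous_flow[OF assms that] cl by (simp add: continuous_closed_vimage
          continuous_on_eq_continuous_at)
    ultimately have "closure D \<subseteq> \<phi> t \<omega> -` closed_nbhd S \<delta>"
      by (intro closure_minimal) auto
    with D(3) show "\<phi> t \<omega> ` C \<subseteq> closed_nbhd S \<delta>" by auto
  qed (use D(2) in auto)
  then have "{\<omega> \<in> space P. \<phi> t \<omega> ` C \<subseteq> closed_nbhd S \<delta>} =
             {\<omega> \<in> space P. \<forall>x\<in>D. \<phi> t \<omega> x \<in> closed_nbhd S \<delta>}" by blast
  also have "\<dots> \<in> sets P"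
  proof (rule sets.sets_Collect_countable_All'[OF _ D(1)])
    show "{\<omega> \<in> space P. \<phi> t \<omega> x \<in> closed_nbhd S \<delta>} \<in> sets P" for x
      using measurable_sets[OF measurable_flow_point[OF assms] borel_closed[OF cl], of x]
      by (simp add: vimage_def Int_def conj_commute)
  qed
  finally show ?thesis .
qed

end

end

theory Submission
  imports Defs
begin

text \<open>
  Call a random compact set attracting if it weakly attracts every compact set. If \<open>x\<close> is close to
  \<open>K \<omega>\<close> and continuous functions \<open>G i \<omega>\<close> are small at \<open>x\<close>, then by compactness \<open>x\<close> is close to the
  common zero set of the \<open>G i \<omega>\<close> in \<open>K \<omega>\<close>. Hence attracting sets are closed under countable
  intersections, and maximising the expected truncated distances to a dense sequence yields an attracting
  set \<open>A\<close> that is almost surely contained in every other one. Both \<open>\<phi> t (\<theta> (- t) \<omega>) ` A (\<theta> (- t) \<omega>)\<close>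
  and \<open>{x \<in> A \<omega>. \<phi> t \<omega> x \<in> A (\<theta> t \<omega>)}\<close> are again attracting, so minimality gives both inclusions of
  strict invariance: (iii) implies (i).

  Condition (ii) follows from (iii) by tightness of random compact sets. For the converse let \<open>C n\<close> belong
  to \<open>\<epsilon> = 2\<^sup>-\<^sup>n\<close>. After a long time the image of \<open>C m\<close> lies near \<open>C n\<close> on an event \<open>W n m\<close> of probability
  at least \<open>1 - 2\<^sup>-\<^sup>n\<close>. This event is fixed while the time in the attraction goes to infinity, and by continuity, on \<open>W n m\<close>,
  the set \<open>C n\<close> almost attracts all compact sets, up to probability \<open>2\<^sup>-\<^sup>m\<close>. So \<open>C n\<close> attracts on
  \<open>V n = limsup\<^sub>m W n m\<close>, and \<open>K \<omega> = C n\<close> for the least \<open>n\<close> with \<open>\<omega> \<in> V n\<close> is attracting.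
\<close>

section \<open>Distances to sets and dense sequences\<close>

lemma pt_dist_eq_0_iff:
  assumes "closed A"
  shows "pt_dist x A = 0 \<longleftrightarrow> x \<in> A"
proof (cases "A = {}")
  case False
  then show ?thesis
    using assms in_closed_iff_infdist_zero[of A x] infdist_nonneg[of x A]
    by (auto simp: pt_dist_infdist ennreal_eq_0_iff)
qed (simp add: pt_dist_infdist)

lemma pt_dist_lessD:
  assumes "pt_dist x A < ennreal e"
  obtains a where "a \<in> A" "dist x a < e"
  using assms unfolding pt_dist_def INF_less_iff
  by (meson ennreal_leI leD leI)

lemma pt_dist_antimono: "A \<subseteq> B \<Longrightarrow> pt_dist x B \<le> pt_dist x A"
  unfolding pt_dist_def by (rule INF_superset_mono) auto

lemma dense_sequence:
  obtains q :: "nat \<Rightarrow> 'a::{second_countable_topology, metric_space}"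
  where "\<And>x e. 0 < e \<Longrightarrow> \<exists>k. dist x (q k) < e"
proof -
  obtain D :: "'a set" where D: "countable D" "\<And>X. open X \<Longrightarrow> X \<noteq> {} \<Longrightarrow> \<exists>d\<in>D. d \<in> X"
    using countable_dense_exists by blast
  have "\<exists>k. dist x (from_nat_into D k) < e" if "0 < e" for x e
  proof -
    have "ball x e \<noteq> {}" using centre_in_ball[of x e] that by blast
    then obtain d where "d \<in> D" "d \<in> ball x e" using D(2)[OF open_ball] by blast
    then show ?thesis
      using from_nat_into_surj[OF D(1)] by (metis mem_ball)
  qed
  with that show thesis by blast
qed

section \<open>Common zero sets of continuous functions near a compact set\<close>

text \<open>One index bounds both the number of functions and the tolerance. Strict inequalities and
  finitely many conditions make these sets open for continuous \<open>G i\<close>, and they decrease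
  to the common zero set.\<close>

definition near_zero :: "(nat \<Rightarrow> 'a \<Rightarrow> ennreal) \<Rightarrow> nat \<Rightarrow> 'a set" where
  "near_zero G n = {x. \<forall>i\<le>n. G i x < ennreal (1 / Suc n)}"

lemma near_zero_antimono:
  assumes "m \<le> n"
  shows "near_zero G n \<subseteq> near_zero G m"
proof -
  have "1 / Suc n \<le> 1 / real (Suc m)"
    using assms by (intro divide_left_mono) auto
  then have le: "ennreal (1 / Suc n) \<le> ennreal (1 / Suc m)"
    by (rule ennreal_leI)
  show ?thesis
  proof
    fix x assume x: "x \<in> near_zero G n"
    have "G i x < ennreal (1 / Suc m)" if "i \<le> m" for i
    proof (rule less_le_trans[OF _ le])
      show "G i x < ennreal (1 / Suc n)"
        using x that assms by (simp add: near_zero_def)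
    qed
    then show "x \<in> near_zero G m"
      by (simp add: near_zero_def)
  qed
qed

lemma open_near_zero:
  fixes G :: "nat \<Rightarrow> 'a::topological_space \<Rightarrow> ennreal"
  assumes "\<And>i. continuous_on UNIV (G i)"
  shows "open (near_zero G n)"
proof -
  have "near_zero G n = (\<Inter>i\<in>{..n}. {x. G i x < ennreal (1 / Suc n)})"
    by (auto simp: near_zero_def)
  also have "open \<dots>"
    by (intro open_INT ballI open_Collect_less assms continuous_on_const) simp
  finally show ?thesis .
qed

lemma zero_in_near_zero: "(\<And>i. G i x = 0) \<Longrightarrow> x \<in> near_zero G n"
  by (simp add: near_zero_def)

text \<open>Since \<open>G 0\<close> is the distance to \<open>K\<close>, points of
  \<open>near_zero G n\<close> outside \<open>U\<close> would have companions in \<open>K\<close> at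
  distance below \<open>1 / Suc n\<close>. A limit point of the companions is a common zero, hence
  lies in \<open>U\<close>, although it is a limit of points outside the open set
  \<open>U\<close>.\<close>

lemma near_zero_subset_open:
  fixes G :: "nat \<Rightarrow> 'a::metric_space \<Rightarrow> ennreal"
  assumes K: "compact K" "\<And>x. G 0 x = pt_dist x K"
    and G: "\<And>i. continuous_on UNIV (G i)"
    and U: "open U" "{x. \<forall>i. G i x = 0} \<subseteq> U"
  obtains n where "near_zero G n \<subseteq> U"
proof (rule ccontr)
  assume "\<not> thesis"
  then have "\<forall>n. \<exists>x. x \<in> near_zero G n \<and> x \<notin> U"
    using that by blast
  then obtain x where x: "\<And>n. x n \<in> near_zero G n" "\<And>n. x n \<notin> U"
    by metis
  have "\<exists>k. k \<in> K \<and> dist (x n) k < 1 / Suc n" for n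
  proof -
    have "pt_dist (x n) K < ennreal (1 / Suc n)"
      using x(1)[of n] K(2) by (auto simp: near_zero_def)
    then show ?thesis by (rule pt_dist_lessD) blast
  qed
  then obtain k where k: "\<And>n. k n \<in> K" "\<And>n. dist (x n) (k n) < 1 / Suc n"
    by metis
  obtain l r where l: "l \<in> K" "strict_mono r" "(k \<circ> r) \<longlonglongrightarrow> l"
    using K(1) k(1) unfolding compact_def by metis
  have "(\<lambda>n. dist (x n) (k n)) \<longlonglongrightarrow> 0"
    by (rule tendsto_sandwich[OF _ _ tendsto_const LIMSEQ_inverse_real_of_nat])
      (use k(2) in \<open>auto simp: inverse_eq_divide intro!: always_eventually less_imp_le\<close>)
  from LIMSEQ_subseq_LIMSEQ[OF this l(2)]
  have "(\<lambda>n. dist ((x \<circ> r) n) ((k \<circ> r) n) + dist ((k \<circ> r) n) l) \<longlonglongrightarrow> 0 + 0"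
    using l(3) unfolding tendsto_dist_iff[of "k \<circ> r"] by (intro tendsto_add) (simp_all add: o_def)
  then have lim: "(x \<circ> r) \<longlonglongrightarrow> l"
    unfolding tendsto_dist_iff[of "x \<circ> r"] add_0_right
    by (rule tendsto_sandwich[OF _ _ tendsto_const, rotated 2])
      (rule always_eventually allI zero_le_dist dist_triangle)+
  have "G i l = 0" for i
  proof -
    have "(\<lambda>n. G i ((x \<circ> r) n)) \<longlonglongrightarrow> G i l"
      using G[of i] by (intro isCont_tendsto_compose[OF _ lim]) (simp add: continuous_on_eq_continuous_at)
    moreover have "(\<lambda>n. G i (x n)) \<longlonglongrightarrow> 0"
    proof (rule tendsto_sandwich[OF _ _ tendsto_const])
      show "(\<lambda>n. ennreal (1 / Suc n)) \<longlonglongrightarrow> 0"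
        using LIMSEQ_inverse_real_of_nat tendsto_ennrealI[of "\<lambda>n. 1 / Suc n" 0 sequentially]
        by (simp add: inverse_eq_divide)
      show "\<forall>\<^sub>F n in sequentially. G i (x n) \<le> ennreal (1 / Suc n)"
        \<comment> \<open>Functions with index beyond \<open>n\<close> are not controlled by
          \<open>near_zero G n\<close>, so the bound for \<open>G i\<close> starts at
          \<open>n = i\<close>.\<close>
        using eventually_ge_at_top[of i]
        by eventually_elim (use x(1) in \<open>auto simp: near_zero_def less_imp_le\<close>)
    qed simp
    then have "(\<lambda>n. G i ((x \<circ> r) n)) \<longlonglongrightarrow> 0"
      by (drule_tac LIMSEQ_subseq_LIMSEQ[OF _ l(2)]) (simp add: o_def)
    ultimately show ?thesis by (rule LIMSEQ_unique)
  qed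
  with U(2) have "l \<in> U" by blast
  with lim U(1) have "\<forall>\<^sub>F n in sequentially. (x \<circ> r) n \<in> U"
    by (rule topological_tendstoD)
  then show False
    using x(2) by (auto simp: eventually_sequentially)
qed

text \<open>The right-hand side only involves countably many points when \<open>D\<close> is countable, which is what
  makes infima over random zero sets measurable.\<close>

lemma INF_zero_set_eq:
  fixes G :: "nat \<Rightarrow> 'a::metric_space \<Rightarrow> ennreal" and h :: "'a \<Rightarrow> ennreal"
  assumes K: "compact K" "\<And>x. G 0 x = pt_dist x K"
    and G: "\<And>i. continuous_on UNIV (G i)" and h: "continuous_on UNIV h"
    and D: "\<And>X. open X \<Longrightarrow> X \<noteq> {} \<Longrightarrow> \<exists>d\<in>D. d \<in> X"
  shows "(INF x\<in>{x. \<forall>i. G i x = 0}. h x) =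
         (SUP n. INF q\<in>D. if q \<in> near_zero G n then h q else \<infinity>)" (is "?l = (SUP n. ?r n)")
proof (rule antisym)
  show "?l \<le> (SUP n. ?r n)"
  proof (rule dense_le)
    \<comment> \<open>Each \<open>a\<close> below the infimum gives the open set
      \<open>{x. a < h x}\<close> around the zero set, which contains some
      \<open>near_zero G n\<close>. An empty zero set is covered too, its infimum being
      infinite.\<close>
    fix a assume "a < ?l"
    then have "{x. \<forall>i. G i x = 0} \<subseteq> {x. a < h x}"
      by (auto intro: less_le_trans INF_lower)
    moreover have "open {x. a < h x}"
      using h by (intro open_Collect_less continuous_on_const)
    ultimately obtain n where "near_zero G n \<subseteq> {x. a < h x}"
      using near_zero_subset_open[of K G "{x. a < h x}"] K G by blast
    then have "a \<le> ?r n"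
      by (intro INF_greatest) (auto simp: less_imp_le)
    also have "\<dots> \<le> (SUP n. ?r n)" by (rule SUP_upper) simp
    finally show "a \<le> (SUP n. ?r n)" .
  qed
  show "(SUP n. ?r n) \<le> ?l"
  proof (intro SUP_least INF_greatest)
    fix n x assume "x \<in> {x. \<forall>i. G i x = 0}"
    then have x: "x \<in> near_zero G n" by (auto intro: zero_in_near_zero)
    show "?r n \<le> h x"
    proof (rule ccontr)
      assume "\<not> ?r n \<le> h x"
      then have "x \<in> near_zero G n \<inter> {x. h x < ?r n}"
        using x by auto
      \<comment> \<open>The point \<open>x\<close> need not lie in \<open>D\<close>; openness moves
        the strict inequality to a point of \<open>D\<close>.\<close>
      moreover have "open (near_zero G n \<inter> {x. h x < ?r n})"
        using G h by (intro open_Int open_near_zero open_Collect_less continuous_on_const)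
      ultimately obtain q where "q \<in> D" "q \<in> near_zero G n" "h q < ?r n"
        using D by blast
      moreover from this have "?r n \<le> h q" by (intro INF_lower2[of q]) auto
      ultimately show False by simp
    qed
  qed
qed

text \<open>Two choices of \<open>h\<close> occur later: the distance from a fixed point makes the
  zero set itself a random set, and the distance between a random point and
  \<open>\<phi> t \<omega> x\<close> does the same for images under the flow.\<close>

lemma measurable_INF_zero_set:
  fixes G :: "nat \<Rightarrow> 'w \<Rightarrow> 'e::polish_space \<Rightarrow> ennreal" and h :: "'w \<Rightarrow> 'e \<Rightarrow> ennreal"
  assumes K: "\<And>\<omega>. \<omega> \<in> space P \<Longrightarrow> compact (K \<omega>)"
      "\<And>\<omega> x. \<omega> \<in> space P \<Longrightarrow> G 0 \<omega> x = pt_dist x (K \<omega>)"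
    and G: "\<And>i \<omega>. \<omega> \<in> space P \<Longrightarrow> continuous_on UNIV (G i \<omega>)"
      "\<And>i x. (\<lambda>\<omega>. G i \<omega> x) \<in> borel_measurable P"
    and h: "\<And>\<omega>. \<omega> \<in> space P \<Longrightarrow> continuous_on UNIV (h \<omega>)"
      "\<And>x. (\<lambda>\<omega>. h \<omega> x) \<in> borel_measurable P"
  shows "(\<lambda>\<omega>. INF x\<in>{x. \<forall>i. G i \<omega> x = 0}. h \<omega> x) \<in> borel_measurable P"
proof -
  obtain D :: "'e set" where D: "countable D" "\<And>X. open X \<Longrightarrow> X \<noteq> {} \<Longrightarrow> \<exists>d\<in>D. d \<in> X"
    using countable_dense_exists by blast
  note [measurable] = G(2) h(2)
  have "(\<lambda>\<omega>. SUP n. INF q\<in>D. if q \<in> near_zero (\<lambda>i. G i \<omega>) n then h \<omega> q else \<infinity>)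
      \<in> borel_measurable P"
    unfolding near_zero_def mem_Collect_eq
    by (intro borel_measurable_SUP borel_measurable_INF D(1)) auto
  then show ?thesis
    by (rule measurable_cong[THEN iffD1, rotated])
      (use K G(1) h(1) D(2) in \<open>intro INF_zero_set_eq[symmetric], auto\<close>)
qed

section \<open>Asymptotic bounds on outer probabilities\<close>

text \<open>The covering events \<open>N\<close> make the notion usable for events that are not known to be measurable.\<close>

definition outer_limsup_le :: "'w measure \<Rightarrow> (real \<Rightarrow> 'w set) \<Rightarrow> real \<Rightarrow> bool" where
  "outer_limsup_le P F p \<longleftrightarrow>
     (\<forall>\<eta>>0. \<forall>\<^sub>F t in at_top. \<exists>N\<in>sets P. F t \<inter> space P \<subseteq> N \<and> measure P N \<le> p + \<eta>)"

lemma outer_limsup_leD: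
  assumes "outer_limsup_le P F p" "0 < \<eta>"
  shows "\<forall>\<^sub>F t in at_top. \<exists>N\<in>sets P. F t \<inter> space P \<subseteq> N \<and> measure P N \<le> p + \<eta>"
  using assms by (simp add: outer_limsup_le_def)

lemma outer_limsup_le_mono:
  assumes "outer_limsup_le P F p" "p \<le> q" "\<forall>\<^sub>F t in at_top. F' t \<inter> space P \<subseteq> F t"
  shows "outer_limsup_le P F' q"
  unfolding outer_limsup_le_def
proof (intro allI impI)
  fix \<eta> :: real assume "0 < \<eta>"
  with assms(1) have "\<forall>\<^sub>F t in at_top. \<exists>N\<in>sets P. F t \<inter> space P \<subseteq> N \<and> measure P N \<le> p + \<eta>"
    by (simp add: outer_limsup_le_def)
  with assms(3)
  show "\<forall>\<^sub>F t in at_top. \<exists>N\<in>sets P. F' t \<inter> space P \<subseteq> N \<and> measure P N \<le> q + \<eta>"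
  proof eventually_elim
    case (elim t)
    then obtain N where "N \<in> sets P" "F t \<inter> space P \<subseteq> N" "measure P N \<le> p + \<eta>" by blast
    with elim(1) assms(2) show ?case by (intro bexI[of _ N]) auto
  qed
qed

lemma outer_limsup_le_approx:
  assumes "\<And>\<eta>. 0 < \<eta> \<Longrightarrow> outer_limsup_le P F (p + \<eta>)"
  shows "outer_limsup_le P F p"
  unfolding outer_limsup_le_def
proof (intro allI impI)
  fix \<eta> :: real assume "0 < \<eta>"
  then have "0 < \<eta> / 2" by simp
  from outer_limsup_leD[OF assms[OF this] this]
  show "\<forall>\<^sub>F t in at_top. \<exists>N\<in>sets P. F t \<inter> space P \<subseteq> N \<and> measure P N \<le> p + \<eta>"
    by (simp add: add.assoc)
qed

lemma outer_limsup_le_reparam: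
  assumes "outer_limsup_le P F p" "filterlim r at_top at_top"
  shows "outer_limsup_le P (\<lambda>t. F (r t)) p"
  unfolding outer_limsup_le_def
proof (intro allI impI)
  fix \<eta> :: real assume "0 < \<eta>"
  with assms(1) have "\<forall>\<^sub>F t in at_top. \<exists>N\<in>sets P. F t \<inter> space P \<subseteq> N \<and> measure P N \<le> p + \<eta>"
    by (simp add: outer_limsup_le_def)
  from eventually_compose_filterlim[OF this assms(2)]
  show "\<forall>\<^sub>F t in at_top. \<exists>N\<in>sets P. F (r t) \<inter> space P \<subseteq> N \<and> measure P N \<le> p + \<eta>" .
qed

lemma outer_limsup_le_translate:
  fixes c :: real
  assumes "outer_limsup_le P F p"
  shows "outer_limsup_le P (\<lambda>t. F (c + t)) p"
  by (rule outer_limsup_le_reparam[OF assms])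
    (rule filterlim_tendsto_add_at_top[OF tendsto_const filterlim_ident])

context prob_space
begin

lemma outer_limsup_le_Un:
  assumes "outer_limsup_le M F p" "outer_limsup_le M F' q"
  shows "outer_limsup_le M (\<lambda>t. F t \<union> F' t) (p + q)"
  unfolding outer_limsup_le_def
proof (intro allI impI)
  fix \<eta> :: real assume "0 < \<eta>"
  then have "\<forall>\<^sub>F t in at_top. \<exists>N\<in>sets M. F t \<inter> space M \<subseteq> N \<and> prob N \<le> p + \<eta> / 2"
    "\<forall>\<^sub>F t in at_top. \<exists>N\<in>sets M. F' t \<inter> space M \<subseteq> N \<and> prob N \<le> q + \<eta> / 2"
    using assms by (auto simp: outer_limsup_le_def)
  then show "\<forall>\<^sub>F t in at_top. \<exists>N\<in>sets M. (F t \<union> F' t) \<inter> space M \<subseteq> N \<and> prob N \<le> p + q + \<eta>"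
  proof eventually_elim
    case (elim t)
    then obtain N N' where N: "N \<in> sets M" "F t \<inter> space M \<subseteq> N" "prob N \<le> p + \<eta> / 2"
      "N' \<in> sets M" "F' t \<inter> space M \<subseteq> N'" "prob N' \<le> q + \<eta> / 2" by blast
    have "prob (N \<union> N') \<le> prob N + prob N'"
      using N by (intro measure_Un_le) auto
    with N show ?case by (intro bexI[of _ "N \<union> N'"]) auto
  qed
qed

lemma outer_limsup_le_const: "N \<in> sets M \<Longrightarrow> outer_limsup_le M (\<lambda>t. N) (prob N)"
  unfolding outer_limsup_le_def by (auto intro!: always_eventually bexI[of _ N])

lemma outer_limsup_le_UN:
  assumes "finite I" "\<And>i. i \<in> I \<Longrightarrow> outer_limsup_le M (F i) (p i)"
  shows "outer_limsup_le M (\<lambda>t. \<Union>i\<in>I. F i t) (\<Sum>i\<in>I. p i)"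
  using assms
proof (induction I)
  case empty
  show ?case using outer_limsup_le_const[of "{}"] by simp
next
  case (insert i I)
  then show ?case using outer_limsup_le_Un[of "F i" "p i" "\<lambda>t. \<Union>i\<in>I. F i t"] by simp
qed

lemma outer_limsup_le_measurable:
  assumes "\<forall>\<^sub>F t in at_top. F t \<in> sets M \<and> prob (F t) \<le> p"
  shows "outer_limsup_le M F p"
  unfolding outer_limsup_le_def
proof (intro allI impI)
  fix \<eta> :: real assume "0 < \<eta>"
  from assms show "\<forall>\<^sub>F t in at_top. \<exists>N\<in>sets M. F t \<inter> space M \<subseteq> N \<and> prob N \<le> p + \<eta>"
  proof eventually_elim
    case (elim t)
    with \<open>0 < \<eta>\<close> show ?case by (intro bexI[of _ "F t"]) auto
  qed
qed

lemma outer_limsup_le_0_iff_tendsto: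
  assumes "\<forall>\<^sub>F t in at_top. F t \<in> sets M"
  shows "outer_limsup_le M F 0 \<longleftrightarrow> ((\<lambda>t. prob (F t)) \<longlongrightarrow> 0) at_top"
proof
  assume F: "outer_limsup_le M F 0"
  show "((\<lambda>t. prob (F t)) \<longlongrightarrow> 0) at_top"
  proof (rule tendstoI)
    fix e :: real assume "0 < e"
    then have "\<forall>\<^sub>F t in at_top. \<exists>N\<in>sets M. F t \<inter> space M \<subseteq> N \<and> prob N \<le> 0 + e / 2"
      using F by (intro outer_limsup_leD) simp_all
    with assms show "\<forall>\<^sub>F t in at_top. dist (prob (F t)) 0 < e"
    proof eventually_elim
      case (elim t)
      then obtain N where N: "N \<in> sets M" "F t \<inter> space M \<subseteq> N" "prob N \<le> e / 2" by auto
      have "prob (F t) \<le> prob N"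
        using N elim(1) sets.sets_into_space by (intro finite_measure_mono) auto
      with N \<open>0 < e\<close> show ?case by simp
    qed
  qed
next
  assume F: "((\<lambda>t. prob (F t)) \<longlongrightarrow> 0) at_top"
  show "outer_limsup_le M F 0"
  proof (rule outer_limsup_le_approx, rule outer_limsup_le_measurable)
    fix e :: real assume "0 < e"
    with F have "\<forall>\<^sub>F t in at_top. prob (F t) < e" by (rule order_tendstoD)
    with assms show "\<forall>\<^sub>F t in at_top. F t \<in> sets M \<and> prob (F t) \<le> 0 + e"
      by eventually_elim simp
  qed
qed

text \<open>Points that approach \<open>K\<close> and the common zeros of the \<open>G i\<close>
  inherit the bound on \<open>H\<close>. The index \<open>n\<close> with
  \<open>H \<omega> \<le> b\<close> on \<open>near_zero\<close> depends on \<open>\<omega>\<close>,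
  but the events \<open>F n\<close> increase to \<open>W\<close>, so one fixed \<open>n\<close>
  works up to probability \<open>\<eta>\<close>. For this \<open>n\<close> only finitely many
  \<open>G i\<close> and one threshold remain, which the assumption labelled \<open>S\<close>
  handles.\<close>

lemma outer_limsup_le_transfer:
  fixes G :: "nat \<Rightarrow> 'a \<Rightarrow> 'e::polish_space \<Rightarrow> ennreal" and H :: "'a \<Rightarrow> 'e \<Rightarrow> ennreal"
  assumes W: "W \<in> sets M"
    and K: "\<And>\<omega>. \<omega> \<in> W \<Longrightarrow> compact (K \<omega>)"
      "\<And>\<omega> x. \<omega> \<in> W \<Longrightarrow> G 0 \<omega> x = pt_dist x (K \<omega>)"
    and G: "\<And>i \<omega>. \<omega> \<in> W \<Longrightarrow> continuous_on UNIV (G i \<omega>)"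
      "\<And>i x. (\<lambda>\<omega>. G i \<omega> x) \<in> borel_measurable M"
    and H: "\<And>\<omega>. \<omega> \<in> W \<Longrightarrow> continuous_on UNIV (H \<omega>)"
      "\<And>x. (\<lambda>\<omega>. H \<omega> x) \<in> borel_measurable M"
    and less: "\<And>\<omega> x. \<omega> \<in> W \<Longrightarrow> (\<And>i. G i \<omega> x = 0) \<Longrightarrow> H \<omega> x < b"
    and S: "\<And>n \<delta>. 0 < \<delta> \<Longrightarrow>
      outer_limsup_le M (\<lambda>t. {\<omega>. \<exists>x\<in>S t \<omega>. \<exists>i\<le>n. ennreal \<delta> < G i \<omega> x}) p"
  shows "outer_limsup_le M (\<lambda>t. {\<omega>\<in>W. \<exists>x\<in>S t \<omega>. b < H \<omega> x}) p"
proof (rule outer_limsup_le_approx)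
  fix \<eta> :: real assume "0 < \<eta>"
  obtain D :: "'e set" where D: "countable D" "\<And>X. open X \<Longrightarrow> X \<noteq> {} \<Longrightarrow> \<exists>d\<in>D. d \<in> X"
    using countable_dense_exists by blast
  \<comment> \<open>Testing only points of \<open>D\<close> keeps the event measurable; continuity
    later extends the bound to all points.\<close>
  define F where "F n = {\<omega>\<in>W. \<forall>q\<in>D. q \<in> near_zero (\<lambda>i. G i \<omega>) n \<longrightarrow> H \<omega> q \<le> b}" for n
  note [measurable] = W G(2) H(2)
  have F_sets: "F n \<in> sets M" for n
  proof -
    have "F n = W \<inter> {\<omega>\<in>space M. \<forall>q\<in>D. q \<in> near_zero (\<lambda>i. G i \<omega>) n \<longrightarrow> H \<omega> q \<le> b}"
      using sets.sets_into_space[OF W] by (auto simp: F_def)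
    also have "\<dots> \<in> sets M"
      unfolding near_zero_def mem_Collect_eq
      by (intro sets.Int W sets.sets_Collect_countable_All'[OF _ D(1)]) measurable
    finally show ?thesis .
  qed
  have "incseq F"
    using near_zero_antimono by (fastforce simp: incseq_def F_def)
  have "(\<Union>n. F n) = W"
  proof
    show "W \<subseteq> (\<Union>n. F n)"
    proof
      fix \<omega> assume \<omega>: "\<omega> \<in> W"
      have "{x. \<forall>i. G i \<omega> x = 0} \<subseteq> {x. H \<omega> x < b}" using less[OF \<omega>] by blast
      moreover have "open {x. H \<omega> x < b}"
        using H(1)[OF \<omega>] by (intro open_Collect_less continuous_on_const)
      ultimately obtain n where "near_zero (\<lambda>i. G i \<omega>) n \<subseteq> {x. H \<omega> x < b}"
        using near_zero_subset_open[of "K \<omega>" "\<lambda>i. G i \<omega>" "{x. H \<omega> x < b}"] K[OF \<omega>] G(1)[OF \<omega>]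
        by blast
      with \<omega> show "\<omega> \<in> (\<Union>n. F n)" by (force simp: F_def less_imp_le)
    qed
  qed (auto simp: F_def)
  then have "(\<lambda>n. prob (F n)) \<longlonglongrightarrow> prob W"
    using finite_Lim_measure_incseq[OF _ \<open>incseq F\<close>] F_sets by auto
  then have "\<forall>\<^sub>F n in sequentially. prob W - \<eta> < prob (F n)"
    using \<open>0 < \<eta>\<close> by (intro order_tendstoD) auto
  then obtain n where n: "prob W - \<eta> < prob (F n)"
    by (auto simp: eventually_sequentially)
  have le_b: "H \<omega> x \<le> b" if "\<omega> \<in> F n" "x \<in> near_zero (\<lambda>i. G i \<omega>) n" for \<omega> x
  proof (rule ccontr)
    assume "\<not> H \<omega> x \<le> b"
    then have "x \<in> near_zero (\<lambda>i. G i \<omega>) n \<inter> {x. b < H \<omega> x}" using that by auto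
    moreover have "open (near_zero (\<lambda>i. G i \<omega>) n \<inter> {x. b < H \<omega> x})"
      using that G(1) H(1)
      by (intro open_Int open_near_zero open_Collect_less continuous_on_const) (auto simp: F_def)
    ultimately obtain q where "q \<in> D" "q \<in> near_zero (\<lambda>i. G i \<omega>) n" "b < H \<omega> q"
      using D(2) by blast
    with that show False by (auto simp: F_def)
  qed
  have "prob (W - F n) = prob W - prob (F n)"
    using F_sets by (intro finite_measure_Diff) (auto simp: F_def)
  with n have small: "p + prob (W - F n) \<le> p + \<eta>" by simp
  \<comment> \<open>A point outside \<open>near_zero\<close> has some \<open>G i\<close> at least
    \<open>1 / Suc n\<close>; the smaller threshold turns this into the strict inequality that the
    events require.\<close>
  have outer: "outer_limsup_le M
      (\<lambda>t. {\<omega>. \<exists>x\<in>S t \<omega>. \<exists>i\<le>n. ennreal (1 / Suc (Suc n)) < G i \<omega> x} \<union> (W - F n)) (p + prob (W - F n))"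
    using F_sets by (intro outer_limsup_le_Un S outer_limsup_le_const) auto
  have less: "ennreal (1 / Suc (Suc n)) < ennreal (1 / Suc n)"
    by (rule ennreal_lessI) (auto simp: field_simps)
  have "{\<omega>\<in>W. \<exists>x\<in>S t \<omega>. b < H \<omega> x} \<inter> space M \<subseteq>
      {\<omega>. \<exists>x\<in>S t \<omega>. \<exists>i\<le>n. ennreal (1 / Suc (Suc n)) < G i \<omega> x} \<union> (W - F n)" for t
  proof
    fix \<omega> assume "\<omega> \<in> {\<omega>\<in>W. \<exists>x\<in>S t \<omega>. b < H \<omega> x} \<inter> space M"
    then obtain x where x: "\<omega> \<in> W" "x \<in> S t \<omega>" "\<not> H \<omega> x \<le> b" by (auto simp: not_le)
    show "\<omega> \<in> {\<omega>. \<exists>x\<in>S t \<omega>. \<exists>i\<le>n. ennreal (1 / Suc (Suc n)) < G i \<omega> x} \<union> (W - F n)"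
    proof (cases "\<omega> \<in> F n")
      case True
      with le_b x have "x \<notin> near_zero (\<lambda>i. G i \<omega>) n" by blast
      then obtain i where "i \<le> n" "ennreal (1 / Suc n) \<le> G i \<omega> x"
        by (auto simp: near_zero_def not_less)
      then have "i \<le> n" "ennreal (1 / Suc (Suc n)) < G i \<omega> x"
        using less_le_trans[OF less] by blast+
      with x(2) show ?thesis by blast
    qed (use x in blast)
  qed
  then show "outer_limsup_le M (\<lambda>t. {\<omega>\<in>W. \<exists>x\<in>S t \<omega>. b < H \<omega> x}) (p + \<eta>)"
    by (intro outer_limsup_le_mono[OF outer small] always_eventually allI)
qed

end

section \<open>Attracting random compact sets and their closure properties\<close>

context continuous_random_dynamical_system
begin

lemma shift_in_space: "\<omega> \<in> space P \<Longrightarrow> \<theta> t \<omega> \<in> space P"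
  using measurable_space[OF measurable_shift_time] by blast

lemma shift_inverse:
  assumes "\<omega> \<in> space P"
  shows "\<theta> t (\<theta> (- t) \<omega>) = \<omega>" "\<theta> (- t) (\<theta> t \<omega>) = \<omega>"
  using shift_add[OF assms, of t "- t"] shift_add[OF assms, of "- t" t] shift_zero[OF assms] by simp_all

lemma prob_shift_vimage:
  assumes "N \<in> sets P"
  shows "prob (\<theta> t -` N \<inter> space P) = prob N"
  using measure_distr[OF measurable_shift_time assms, of t] shift_preserves[of t] by simp

lemma AE_shift:
  assumes "AE \<omega> in P. Q \<omega>"
  shows "AE \<omega> in P. Q (\<theta> t \<omega>)"
proof (rule AE_distrD[OF measurable_shift_time])
  show "AE \<omega> in distr P P (\<theta> t). Q \<omega>"
    unfolding shift_preserves using assms .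
qed

text \<open>Preimages of covering events under the shift keep their probability, and the amount of
  shift may vary with \<open>t\<close>. With \<open>r t = - t\<close> this passes from forward to
  pullback time.\<close>

lemma outer_limsup_le_shift:
  assumes "outer_limsup_le P F p"
  shows "outer_limsup_le P (\<lambda>t. \<theta> (r t) -` F t) p"
  unfolding outer_limsup_le_def
proof (intro allI impI)
  fix \<eta> :: real assume "0 < \<eta>"
  from outer_limsup_leD[OF assms this]
  show "\<forall>\<^sub>F t in at_top. \<exists>N\<in>sets P. \<theta> (r t) -` F t \<inter> space P \<subseteq> N \<and> prob N \<le> p + \<eta>"
  proof eventually_elim
    case (elim t)
    then obtain N where N: "N \<in> sets P" "F t \<inter> space P \<subseteq> N" "prob N \<le> p + \<eta>" by blast
    show ?case
    proof (intro bexI conjI)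
      show "\<theta> (r t) -` N \<inter> space P \<in> sets P"
        using measurable_shift_time N(1) by (rule measurable_sets)
      show "prob (\<theta> (r t) -` N \<inter> space P) \<le> p + \<eta>"
        using N prob_shift_vimage by simp
      show "\<theta> (r t) -` F t \<inter> space P \<subseteq> \<theta> (r t) -` N \<inter> space P"
        using N(2) shift_in_space by blast
    qed
  qed
qed

text \<open>Attraction is phrased through outer bounds, so no measurability of the events is
  presupposed. Almost sure non-emptiness follows from it, because the distance to the empty set is
  infinite.\<close>

definition attracting :: "('w \<Rightarrow> 'e set) \<Rightarrow> bool" where
  "attracting K \<longleftrightarrow>
     (\<forall>\<omega>\<in>space P. compact (K \<omega>)) \<and>
     (\<forall>x. (\<lambda>\<omega>. pt_dist x (K \<omega>)) \<in> borel_measurable P) \<and>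
     (\<forall>B. compact B \<longrightarrow> (\<forall>\<delta>>0.
        outer_limsup_le P (\<lambda>t. {\<omega>. \<exists>x\<in>\<phi> t (\<theta> (- t) \<omega>) ` B. ennreal \<delta> < pt_dist x (K \<omega>)}) 0))"

lemma attractingD:
  assumes "attracting K"
  shows "\<omega> \<in> space P \<Longrightarrow> compact (K \<omega>)"
    "(\<lambda>\<omega>. pt_dist x (K \<omega>)) \<in> borel_measurable P"
    "compact B \<Longrightarrow> 0 < \<delta> \<Longrightarrow>
       outer_limsup_le P (\<lambda>t. {\<omega>. \<exists>x\<in>\<phi> t (\<theta> (- t) \<omega>) ` B. ennreal \<delta> < pt_dist x (K \<omega>)}) 0"
  using assms by (auto simp: attracting_def)

lemma attracting_cong:
  assumes "\<And>\<omega>. \<omega> \<in> space P \<Longrightarrow> K \<omega> = K' \<omega>" "attracting K"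
  shows "attracting K'"
  unfolding attracting_def
proof (intro conjI allI impI ballI)
  show "compact (K' \<omega>)" if "\<omega> \<in> space P" for \<omega>
    using attractingD(1)[OF assms(2) that] assms(1)[OF that] by simp
  show "(\<lambda>\<omega>. pt_dist x (K' \<omega>)) \<in> borel_measurable P" for x
    by (rule measurable_cong[THEN iffD1, OF _ attractingD(2)[OF assms(2)]]) (simp add: assms(1))
  show "outer_limsup_le P (\<lambda>t. {\<omega>. \<exists>x\<in>\<phi> t (\<theta> (- t) \<omega>) ` B. ennreal \<delta> < pt_dist x (K' \<omega>)}) 0"
    if "compact B" "0 < \<delta>" for B and \<delta> :: real
    by (rule outer_limsup_le_mono[OF attractingD(3)[OF assms(2) that] order_refl])
      (intro always_eventually, use assms(1) in auto)
qed

text \<open>Here \<open>outer_limsup_le_transfer\<close> is used with the distance to the zero set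
  as \<open>H\<close>: it vanishes at every common zero, hence is below each \<open>\<delta>\<close>
  there. Compactness of \<open>K \<omega>\<close> enters through \<open>G 0\<close>.\<close>

lemma attracting_zero_set:
  fixes G :: "nat \<Rightarrow> 'w \<Rightarrow> 'e \<Rightarrow> ennreal"
  assumes K: "attracting K"
    and G: "\<And>\<omega> x. \<omega> \<in> space P \<Longrightarrow> G 0 \<omega> x = pt_dist x (K \<omega>)"
      "\<And>i \<omega>. \<omega> \<in> space P \<Longrightarrow> continuous_on UNIV (G i \<omega>)"
      "\<And>i x. (\<lambda>\<omega>. G i \<omega> x) \<in> borel_measurable P"
    and small: "\<And>i B \<delta>. compact B \<Longrightarrow> 0 < \<delta> \<Longrightarrow>
      outer_limsup_le P (\<lambda>t. {\<omega>. \<exists>x\<in>\<phi> t (\<theta> (- t) \<omega>) ` B. ennreal \<delta> < G i \<omega> x}) 0"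
  shows "attracting (\<lambda>\<omega>. {x. \<forall>i. G i \<omega> x = 0})" (is "attracting ?Z")
  unfolding attracting_def
proof (intro conjI allI impI ballI)
  show cpt: "compact (?Z \<omega>)" if \<omega>: "\<omega> \<in> space P" for \<omega>
  proof -
    have "closed (?Z \<omega>)"
      using G(2)[OF \<omega>] by (intro closed_Collect_all closed_Collect_eq continuous_on_const)
    moreover have "?Z \<omega> \<subseteq> K \<omega>"
      using pt_dist_eq_0_iff[OF compact_imp_closed[OF attractingD(1)[OF K \<omega>]]] G(1)[OF \<omega>]
      by (metis (mono_tags, lifting) mem_Collect_eq subsetI)
    ultimately show ?thesis
      using compact_Int_closed[OF attractingD(1)[OF K \<omega>]] by (metis inf.absorb_iff2)
  qed
  have dist: "continuous_on UNIV (\<lambda>y. ennreal (dist x y))" for x :: 'e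
    by (intro continuous_on_ennreal continuous_on_dist continuous_on_const continuous_on_id)
  show meas: "(\<lambda>\<omega>. pt_dist x (?Z \<omega>)) \<in> borel_measurable P" for x
    unfolding pt_dist_def
    by (rule measurable_INF_zero_set[of P K G "\<lambda>\<omega> y. ennreal (dist x y)"])
      (auto simp: G attractingD(1)[OF K] dist)
  fix B :: "'e set" and \<delta> :: real assume B: "compact B" "0 < \<delta>"
  have "outer_limsup_le P
      (\<lambda>t. {\<omega>\<in>space P. \<exists>x\<in>\<phi> t (\<theta> (- t) \<omega>) ` B. ennreal \<delta> < pt_dist x (?Z \<omega>)}) 0"
  proof (rule outer_limsup_le_transfer[where K = K and G = G])
    show "pt_dist x (?Z \<omega>) < ennreal \<delta>" if "\<omega> \<in> space P" "\<And>i. G i \<omega> x = 0" for \<omega> x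
      using pt_dist_eq_0_iff[OF compact_imp_closed[OF cpt[OF that(1)]], of x] that(2) B(2) by simp
    show "outer_limsup_le P
        (\<lambda>t. {\<omega>. \<exists>x\<in>\<phi> t (\<theta> (- t) \<omega>) ` B. \<exists>i\<le>n. ennreal \<delta>' < G i \<omega> x}) 0" if "0 < \<delta>'" for n \<delta>'
    proof -
      have "outer_limsup_le P
          (\<lambda>t. \<Union>i\<in>{..n}. {\<omega>. \<exists>x\<in>\<phi> t (\<theta> (- t) \<omega>) ` B. ennreal \<delta>' < G i \<omega> x}) (\<Sum>i\<in>{..n}. 0)"
        using small[OF B(1) that] by (intro outer_limsup_le_UN) auto
      then show ?thesis
        by (rule outer_limsup_le_mono) (auto intro!: always_eventually)
    qed
  qed (use attractingD(1)[OF K] G meas continuous_pt_dist in auto)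
  then show "outer_limsup_le P
      (\<lambda>t. {\<omega>. \<exists>x\<in>\<phi> t (\<theta> (- t) \<omega>) ` B. ennreal \<delta> < pt_dist x (?Z \<omega>)}) 0"
    by (rule outer_limsup_le_mono) (auto intro!: always_eventually)
qed

text \<open>An intersection of closed sets is the zero set of the distances to them;
  \<open>K 0\<close> supplies the compact set.\<close>

lemma attracting_INT:
  assumes K: "\<And>n::nat. attracting (K n)"
  shows "attracting (\<lambda>\<omega>. \<Inter>n. K n \<omega>)"
proof (rule attracting_cong)
  show "attracting (\<lambda>\<omega>. {x. \<forall>n. pt_dist x (K n \<omega>) = 0})"
    by (rule attracting_zero_set[OF K[of 0]])
      (use attractingD[OF K] continuous_pt_dist in auto)
  show "{x. \<forall>n. pt_dist x (K n \<omega>) = 0} = (\<Inter>n. K n \<omega>)" if "\<omega> \<in> space P" for \<omega>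
    using pt_dist_eq_0_iff[OF compact_imp_closed[OF attractingD(1)[OF K that]]] by auto
qed

lemma attracting_Int:
  assumes "attracting K" "attracting K'"
  shows "attracting (\<lambda>\<omega>. K \<omega> \<inter> K' \<omega>)"
proof -
  have "attracting (\<lambda>\<omega>. \<Inter>n. (if n = (0::nat) then K else K') \<omega>)"
    using assms by (intro attracting_INT) simp
  also have "(\<lambda>\<omega>. \<Inter>n. (if n = (0::nat) then K else K') \<omega>) = (\<lambda>\<omega>. K \<omega> \<inter> K' \<omega>)"
  proof
    show "(\<Inter>n. (if n = (0::nat) then K else K') \<omega>) = K \<omega> \<inter> K' \<omega>" for \<omega>
      using INT_lower[of 0 UNIV "\<lambda>n::nat. (if n = 0 then K else K') \<omega>"]
        INT_lower[of 1 UNIV "\<lambda>n::nat. (if n = 0 then K else K') \<omega>"]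
      by auto
  qed
  finally show ?thesis .
qed

lemma flow_shift_past:
  assumes "\<omega> \<in> space P" "0 \<le> s" "0 \<le> t"
  shows "\<phi> (t + s) (\<theta> (- s) \<omega>) x = \<phi> t \<omega> (\<phi> s (\<theta> (- s) \<omega>) x)"
  using cocycle[OF assms(2,3) shift_in_space[OF assms(1)], of "- s" x] shift_inverse(1)[OF assms(1)]
  by simp

text \<open>Running the flow for a further fixed time \<open>t\<close> turns the pullback image at
  time \<open>s\<close> over \<open>\<omega>\<close> into the one at time \<open>t + s\<close> over
  \<open>\<theta> t \<omega>\<close>. Shifting by \<open>- t\<close> and substituting
  \<open>u = t + s\<close> both keep the bound.\<close>

lemma outer_limsup_le_push:
  fixes g :: "'w \<Rightarrow> 'e \<Rightarrow> ennreal"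
  assumes "outer_limsup_le P (\<lambda>s. {\<omega>\<in>W. \<exists>x\<in>\<phi> s (\<theta> (- s) \<omega>) ` B. b < g \<omega> (\<phi> t \<omega> x)}) p"
    and t: "0 \<le> t"
  shows "outer_limsup_le P
    (\<lambda>s. {\<omega>\<in>\<theta> (- t) -` W. \<exists>x\<in>\<phi> s (\<theta> (- s) \<omega>) ` B. b < g (\<theta> (- t) \<omega>) x}) p"
  using outer_limsup_le_translate[OF outer_limsup_le_shift[OF assms(1), of "\<lambda>_. - t"], of "- t"]
proof (rule outer_limsup_le_mono)
  show "\<forall>\<^sub>F u in at_top.
      {\<omega>\<in>\<theta> (- t) -` W. \<exists>x\<in>\<phi> u (\<theta> (- u) \<omega>) ` B. b < g (\<theta> (- t) \<omega>) x} \<inter> space P \<subseteq>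
      \<theta> (- t) -` {\<omega>\<in>W. \<exists>x\<in>\<phi> (- t + u) (\<theta> (- (- t + u)) \<omega>) ` B. b < g \<omega> (\<phi> t \<omega> x)}"
    \<comment> \<open>The elapsed time \<open>- t + u\<close> has to be non-negative for the cocycle
      law.\<close>
    using eventually_ge_at_top[of t]
  proof eventually_elim
    case (elim u)
    have "\<phi> t (\<theta> (- t) \<omega>) (\<phi> (- t + u) (\<theta> (- (- t + u)) (\<theta> (- t) \<omega>)) x) =
        \<phi> u (\<theta> (- u) \<omega>) x" if "\<omega> \<in> space P" for \<omega> x
      using flow_shift_past[OF shift_in_space[OF that], of "- t + u" t "- t" x] elim t
        shift_add[OF that, of "- (- t + u)" "- t"] by simp
    then show ?case by auto
  qed
qed simp

lemma measurable_dist_flow: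
  assumes "0 \<le> t" "g \<in> borel_measurable P"
  shows "(\<lambda>\<omega>. ennreal (dist (g \<omega>) (\<phi> t \<omega> x))) \<in> borel_measurable P"
  using measurable_flow_point[OF assms(1)] assms(2)
  by (intro measurable_compose[OF _ measurable_ennreal] borel_measurable_dist)

text \<open>If \<open>x\<close> is close to \<open>K \<omega>\<close>, continuity puts
  \<open>\<phi> t \<omega> x\<close> close to the image of \<open>K \<omega>\<close>;
  \<open>outer_limsup_le_transfer\<close> makes this uniform off a small event. The further time
  \<open>t\<close> is then absorbed by \<open>outer_limsup_le_push\<close>.\<close>

lemma attracting_image:
  assumes K: "attracting K" and t: "0 \<le> t"
  shows "attracting (\<lambda>\<omega>. \<phi> t (\<theta> (- t) \<omega>) ` K (\<theta> (- t) \<omega>))"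
proof -
  \<comment> \<open>The image is first studied over its starting point; the shift by
    \<open>- t\<close> comes last.\<close>
  define I where "I \<omega> = \<phi> t \<omega> ` K \<omega>" for \<omega>
  have cpt: "compact (I \<omega>)" if "\<omega> \<in> space P" for \<omega>
    unfolding I_def using attractingD(1)[OF K that] continuous_flow[OF t that]
    by (intro compact_continuous_image) (auto intro: continuous_on_subset)
  have cont: "continuous_on UNIV (\<lambda>q. ennreal (dist y (\<phi> t \<omega> q)))" if "\<omega> \<in> space P" for y \<omega>
    by (intro continuous_on_ennreal continuous_on_dist continuous_on_const
        continuous_flow[OF t that])
  \<comment> \<open>A random \<open>g\<close> is allowed because the transfer below measures the
    distance from \<open>\<phi> t \<omega> x\<close>.\<close>
  have meas: "(\<lambda>\<omega>. pt_dist (g \<omega>) (I \<omega>)) \<in> borel_measurable P" if g: "g \<in> borel_measurable P" for g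
  proof -
    \<comment> \<open>\<open>K \<omega>\<close> is written as a zero set with a family constant in
      \<open>i\<close>, so that the infimum over the image becomes one over a zero set.\<close>
    have "(\<lambda>\<omega>. INF x\<in>{x. \<forall>i::nat. pt_dist x (K \<omega>) = 0}. ennreal (dist (g \<omega>) (\<phi> t \<omega> x)))
        \<in> borel_measurable P"
      by (rule measurable_INF_zero_set[where G = "\<lambda>i \<omega> x. pt_dist x (K \<omega>)"])
        (use attractingD[OF K] continuous_pt_dist cont measurable_dist_flow[OF t g] in auto)
    moreover have "pt_dist (g \<omega>) (I \<omega>) =
        (INF x\<in>{x. \<forall>i::nat. pt_dist x (K \<omega>) = 0}. ennreal (dist (g \<omega>) (\<phi> t \<omega> x)))"
      if "\<omega> \<in> space P" for \<omega>
      using pt_dist_eq_0_iff[OF compact_imp_closed[OF attractingD(1)[OF K that]]]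
      by (simp add: I_def pt_dist_def image_image)
    ultimately show ?thesis by (subst measurable_cong) auto
  qed
  have "attracting (\<lambda>\<omega>. I (\<theta> (- t) \<omega>))"
    unfolding attracting_def
  proof (intro conjI allI impI ballI)
    show "compact (I (\<theta> (- t) \<omega>))" if "\<omega> \<in> space P" for \<omega>
      using cpt shift_in_space[OF that] by blast
    show "(\<lambda>\<omega>. pt_dist x (I (\<theta> (- t) \<omega>))) \<in> borel_measurable P" for x
      by (rule measurable_compose[OF measurable_shift_time meas]) simp
    fix B :: "'e set" and \<delta> :: real assume B: "compact B" "0 < \<delta>"
    have "outer_limsup_le P (\<lambda>s. {\<omega>\<in>space P. \<exists>x\<in>\<phi> s (\<theta> (- s) \<omega>) ` B.
        ennreal \<delta> < pt_dist (\<phi> t \<omega> x) (I \<omega>)}) 0"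
    proof (rule outer_limsup_le_transfer[where K = K and G = "\<lambda>i \<omega> x. pt_dist x (K \<omega>)"])
      show "pt_dist (\<phi> t \<omega> x) (I \<omega>) < ennreal \<delta>"
        if "\<omega> \<in> space P" "\<And>i::nat. pt_dist x (K \<omega>) = 0" for \<omega> x
      proof -
        have "x \<in> K \<omega>"
          using pt_dist_eq_0_iff[OF compact_imp_closed[OF attractingD(1)[OF K that(1)]]] that(2)
          by simp
        then have "\<phi> t \<omega> x \<in> I \<omega>" by (simp add: I_def)
        then have "pt_dist (\<phi> t \<omega> x) (I \<omega>) = 0"
          using pt_dist_eq_0_iff[OF compact_imp_closed[OF cpt[OF that(1)]]] by simp
        with B(2) show ?thesis by simp
      qed
      show "continuous_on UNIV (\<lambda>x. pt_dist (\<phi> t \<omega> x) (I \<omega>))" if "\<omega> \<in> space P" for \<omega>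
        by (rule continuous_on_compose2[OF continuous_pt_dist continuous_flow[OF t that]]) simp
      show "(\<lambda>\<omega>. pt_dist (\<phi> t \<omega> x) (I \<omega>)) \<in> borel_measurable P" for x
        by (rule meas[OF measurable_flow_point[OF t]])
      show "outer_limsup_le P (\<lambda>s. {\<omega>. \<exists>x\<in>\<phi> s (\<theta> (- s) \<omega>) ` B. \<exists>i\<le>n.
          ennreal \<delta>' < pt_dist x (K \<omega>)}) 0" if "0 < \<delta>'" for n :: nat and \<delta>'
        by (rule outer_limsup_le_mono[OF attractingD(3)[OF K B(1) that] order_refl])
          (auto intro!: always_eventually)
    qed (use attractingD[OF K] continuous_pt_dist in auto)
    from outer_limsup_le_push[where g = "\<lambda>\<omega> x. pt_dist x (I \<omega>)", OF this t]
    show "outer_limsup_le P (\<lambda>u. {\<omega>. \<exists>x\<in>\<phi> u (\<theta> (- u) \<omega>) ` B.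
        ennreal \<delta> < pt_dist x (I (\<theta> (- t) \<omega>))}) 0"
      by (rule outer_limsup_le_mono) (auto simp: shift_in_space intro!: always_eventually)
  qed
  then show ?thesis by (simp add: I_def)
qed

text \<open>For \<open>x\<close> in the pullback image of \<open>B\<close> at time \<open>u\<close>,
  the point \<open>\<phi> t \<omega> x\<close> lies in the pullback image at time
  \<open>t + u\<close> over \<open>\<theta> t \<omega>\<close>. Attraction by \<open>K\<close> at
  the later base point therefore makes its distance to \<open>K (\<theta> t \<omega>)\<close> small,
  and the set in question is the common zero set of two small functions.\<close>

lemma attracting_Int_preimage:
  assumes K: "attracting K" and t: "0 \<le> t"
  shows "attracting (\<lambda>\<omega>. {x \<in> K \<omega>. \<phi> t \<omega> x \<in> K (\<theta> t \<omega>)})"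
proof (rule attracting_cong)
  define G where "G i \<omega> x = (if i = 0 then pt_dist x (K \<omega>) else pt_dist (\<phi> t \<omega> x) (K (\<theta> t \<omega>)))"
    for i :: nat and \<omega> x
  show "attracting (\<lambda>\<omega>. {x. \<forall>i. G i \<omega> x = 0})"
  proof (rule attracting_zero_set[OF K])
    show "continuous_on UNIV (G i \<omega>)" if "\<omega> \<in> space P" for i \<omega>
      using continuous_pt_dist
        continuous_on_compose2[OF continuous_pt_dist continuous_flow[OF t that]]
      by (cases "i = 0") (simp_all add: G_def)
    have "(\<lambda>\<omega>. pt_dist (\<phi> t \<omega> x) (K (\<theta> t \<omega>))) \<in> borel_measurable P" for x
      by (rule measurable_pt_dist_random_set[OF _ measurable_flow_point[OF t]])
        (rule measurable_compose[OF measurable_shift_time attractingD(2)[OF K]])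
    then show "(\<lambda>\<omega>. G i \<omega> x) \<in> borel_measurable P" for i x
      unfolding G_def using attractingD(2)[OF K] by simp
    fix i and B :: "'e set" and \<delta> :: real assume B: "compact B" "0 < \<delta>"
    have "outer_limsup_le P
        (\<lambda>u. {\<omega>. \<exists>x\<in>\<phi> u (\<theta> (- u) \<omega>) ` B. ennreal \<delta> < pt_dist (\<phi> t \<omega> x) (K (\<theta> t \<omega>))}) 0"
    proof (rule outer_limsup_le_mono)
      from outer_limsup_le_translate[OF attractingD(3)[OF K B], of t]
      have "outer_limsup_le P
          (\<lambda>u. {\<omega>. \<exists>x\<in>\<phi> (t + u) (\<theta> (- (t + u)) \<omega>) ` B. ennreal \<delta> < pt_dist x (K \<omega>)}) 0" .
      from outer_limsup_le_shift[OF this, of "\<lambda>_. t"]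
      show "outer_limsup_le P (\<lambda>u. \<theta> t -`
          {\<omega>. \<exists>x\<in>\<phi> (t + u) (\<theta> (- (t + u)) \<omega>) ` B. ennreal \<delta> < pt_dist x (K \<omega>)}) 0" .
      show "\<forall>\<^sub>F u in at_top.
          {\<omega>. \<exists>x\<in>\<phi> u (\<theta> (- u) \<omega>) ` B. ennreal \<delta> < pt_dist (\<phi> t \<omega> x) (K (\<theta> t \<omega>))} \<inter> space P \<subseteq>
          \<theta> t -` {\<omega>. \<exists>x\<in>\<phi> (t + u) (\<theta> (- (t + u)) \<omega>) ` B. ennreal \<delta> < pt_dist x (K \<omega>)}"
        using eventually_ge_at_top[of 0]
      proof eventually_elim
        case (elim u)
        have "\<phi> (t + u) (\<theta> (- (t + u)) (\<theta> t \<omega>)) x = \<phi> t \<omega> (\<phi> u (\<theta> (- u) \<omega>) x)"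
          if "\<omega> \<in> space P" for \<omega> x
          using flow_shift_past[OF that elim t, of x] shift_add[OF that, of "- (t + u)" t] by simp
        then show ?case by auto
      qed
    qed simp
    then show "outer_limsup_le P (\<lambda>t. {\<omega>. \<exists>x\<in>\<phi> t (\<theta> (- t) \<omega>) ` B. ennreal \<delta> < G i \<omega> x}) 0"
      unfolding G_def using attractingD(3)[OF K B] by (cases "i = 0") simp_all
  qed (simp add: G_def)
  show "{x. \<forall>i. G i \<omega> x = 0} = {x \<in> K \<omega>. \<phi> t \<omega> x \<in> K (\<theta> t \<omega>)}" if "\<omega> \<in> space P" for \<omega>
    using pt_dist_eq_0_iff[OF compact_imp_closed[OF attractingD(1)[OF K that]]]
      pt_dist_eq_0_iff[OF compact_imp_closed[OF attractingD(1)[OF K shift_in_space[OF that]]]]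
    by (auto simp: G_def split: if_splits)
qed


section \<open>The minimal attracting set\<close>

text \<open>Exhaustion: the supremum of each \<open>f k\<close> is approached along a sequence of
  sets, and the intersection of all these sequences attains every supremum. Intersecting
  \<open>A\<close> with a further attracting set cannot increase any \<open>f k\<close>, so almost
  surely no truncated distance from a \<open>q k\<close> changes, and density of the
  \<open>q k\<close> gives the inclusion.\<close>

lemma attracting_minimal:
  assumes "attracting K\<^sub>0"
  obtains A where "attracting A" "\<And>K. attracting K \<Longrightarrow> AE \<omega> in P. A \<omega> \<subseteq> K \<omega>"
proof -
  obtain q :: "nat \<Rightarrow> 'e" where q: "\<And>x e. 0 < e \<Longrightarrow> \<exists>k. dist x (q k) < e"
    using dense_sequence by metis
  \<comment> \<open>Larger distances mean smaller sets, so a minimal set maximises all \<open>f k\<close>.\<close>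
  define f where "f k K = (\<integral>\<^sup>+\<omega>. min 1 (pt_dist (q k) (K \<omega>)) \<partial>P)" for k K
  have "\<exists>K. \<forall>j::nat. attracting (K j) \<and> (SUP K\<in>Collect attracting. f k K) = (SUP j. f k (K j))" for k
  proof -
    have "Collect attracting \<noteq> {}" using assms by blast
    from ennreal_SUP_countable_SUP[OF this, of "f k"]
    obtain g :: "nat \<Rightarrow> ennreal" where g: "range g \<subseteq> f k ` Collect attracting"
      "(SUP K\<in>Collect attracting. f k K) = (SUP j. g j)" by blast
    from g(1) have "\<forall>j. \<exists>K. attracting K \<and> g j = f k K" by blast
    then obtain K where "\<And>j. attracting (K j) \<and> g j = f k (K j)" by metis
    with g(2) show ?thesis by (intro exI[of _ K]) simp
  qed
  then obtain Ks where Ks: "\<And>k j::nat. attracting (Ks k j)"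
    "\<And>k. (SUP K\<in>Collect attracting. f k K) = (SUP j. f k (Ks k j))" by metis
  define A where "A \<omega> = (\<Inter>n. Ks (fst (prod_decode n)) (snd (prod_decode n)) \<omega>)" for \<omega>
  have A: "attracting A"
    unfolding A_def using Ks(1) by (intro attracting_INT)
  have A_sub: "A \<omega> \<subseteq> Ks k j \<omega>" for \<omega> k j
    unfolding A_def by (rule INF_lower2[of "prod_encode (k, j)"]) simp_all
  have le_A: "f k K \<le> f k A" if "attracting K" for k K
  proof -
    have "f k K \<le> (SUP K\<in>Collect attracting. f k K)" using that by (intro SUP_upper) simp
    also have "\<dots> \<le> f k A"
      unfolding Ks(2) unfolding f_def
      by (intro SUP_least nn_integral_mono min.mono order_refl pt_dist_antimono A_sub)
    finally show ?thesis .
  qed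
  have "AE \<omega> in P. A \<omega> \<subseteq> K \<omega>" if K: "attracting K" for K
  proof -
    define Z where "Z \<omega> = A \<omega> \<inter> K \<omega>" for \<omega>
    have Z: "attracting Z" unfolding Z_def by (rule attracting_Int[OF A K])
    have meas [measurable]: "(\<lambda>\<omega>. pt_dist x (A \<omega>)) \<in> borel_measurable P"
      "(\<lambda>\<omega>. pt_dist x (Z \<omega>)) \<in> borel_measurable P" for x
      using attractingD(2)[OF A] attractingD(2)[OF Z] by auto
    have "AE \<omega> in P. min 1 (pt_dist (q k) (Z \<omega>)) \<le> min 1 (pt_dist (q k) (A \<omega>))" for k
    proof -
      \<comment> \<open>Truncation at 1 keeps the integrals finite, so that they may be
        subtracted.\<close>
      have "f k A \<le> (\<integral>\<^sup>+\<omega>. 1 \<partial>P)" unfolding f_def by (intro nn_integral_mono) simp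
      then have fin: "f k A \<noteq> \<infinity>" by (auto simp: emeasure_space_1 top_unique)
      have "(\<integral>\<^sup>+\<omega>. min 1 (pt_dist (q k) (Z \<omega>)) - min 1 (pt_dist (q k) (A \<omega>)) \<partial>P) = f k Z - f k A"
        unfolding f_def
      proof (rule nn_integral_diff)
        show "AE \<omega> in P. min 1 (pt_dist (q k) (A \<omega>)) \<le> min 1 (pt_dist (q k) (Z \<omega>))"
          unfolding Z_def by (intro AE_I2 min.mono order_refl pt_dist_antimono Int_lower1)
      qed (use fin in \<open>auto simp: f_def\<close>)
      also have "\<dots> = 0"
        using le_A[OF Z, of k] fin by (simp add: ennreal_minus_eq_0 diff_eq_0_iff_ennreal top.not_eq_extremum)
      finally have "AE \<omega> in P. min 1 (pt_dist (q k) (Z \<omega>)) - min 1 (pt_dist (q k) (A \<omega>)) = 0"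
        by (subst (asm) nn_integral_0_iff_AE) auto
      then show ?thesis
        by eventually_elim (rule ennreal_minus_eq_0)
    qed
    then have "AE \<omega> in P. \<forall>k. min 1 (pt_dist (q k) (Z \<omega>)) \<le> min 1 (pt_dist (q k) (A \<omega>))"
      by (subst AE_all_countable) simp
    then show ?thesis
      using AE_space
    proof eventually_elim
      case (elim \<omega>)
      show ?case
      proof
        fix x assume x: "x \<in> A \<omega>"
        have "pt_dist x (Z \<omega>) \<le> 0"
        proof (rule ennreal_le_epsilon)
          fix e :: real assume "0 < e"
          \<comment> \<open>\<open>e'\<close> stays below 1, where the truncation is inactive, and
            two steps of size \<open>e'\<close> through \<open>q k\<close> cost at most
            \<open>e\<close>.\<close>
          define e' where "e' = min (e / 2) (1 / 2)"
          have e': "0 < e'" "e' + e' \<le> e" "e' < 1" using \<open>0 < e\<close> by (auto simp: e'_def)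
          from q[OF e'(1)] obtain k where k: "dist x (q k) < e'" by blast
          have "pt_dist (q k) (A \<omega>) \<le> ennreal (dist (q k) x)"
            unfolding pt_dist_def using x by (rule INF_lower)
          also have "\<dots> \<le> ennreal e'" using k by (intro ennreal_leI) (simp add: dist_commute)
          finally have "min 1 (pt_dist (q k) (Z \<omega>)) \<le> ennreal e'"
            using elim(1) by (meson min.cobounded2 order_trans)
          moreover have "ennreal e' < 1" using e' by (simp add: ennreal_less_one_iff)
          ultimately have "pt_dist (q k) (Z \<omega>) \<le> ennreal e'"
            by (auto simp: min_le_iff_disj)
          moreover have "ennreal (dist (q k) x) \<le> ennreal e'"
            using k by (intro ennreal_leI) (simp add: dist_commute)
          ultimately have "pt_dist x (Z \<omega>) \<le> ennreal e' + ennreal e'"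
            using pt_dist_triangle[of x "Z \<omega>" "q k"] by (meson add_mono order_trans)
          also have "\<dots> \<le> 0 + ennreal e"
            using e' by (simp add: ennreal_leI flip: ennreal_plus)
          finally show "pt_dist x (Z \<omega>) \<le> 0 + ennreal e" .
        qed
        then have "x \<in> Z \<omega>"
          using pt_dist_eq_0_iff[OF compact_imp_closed[OF attractingD(1)[OF Z elim(2)]], of x] by simp
        then show "x \<in> K \<omega>" by (simp add: Z_def)
      qed
    qed
  qed
  with A that show thesis by blast
qed

section \<open>Weak attraction and weak attractors\<close>

text \<open>Where \<open>K \<omega>\<close> is empty, every point has infinite distance from it, so
  \<open>E\<close> lies in the event that attraction of a non-empty test set fails, at every
  time.\<close>

lemma attracting_AE_nonempty:
  assumes K: "attracting K"
  shows "AE \<omega> in P. K \<omega> \<noteq> {}"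
proof -
  define E where "E = {\<omega>\<in>space P. pt_dist undefined (K \<omega>) = \<infinity>}"
  note [measurable] = attractingD(2)[OF K]
  have E: "E \<in> sets P" unfolding E_def by measurable
  have "prob E \<le> 0"
  proof (rule field_le_epsilon)
    fix \<eta> :: real assume "0 < \<eta>"
    \<comment> \<open>The singleton of an arbitrary point serves as the test set, with threshold
      1.\<close>
    from outer_limsup_leD[OF attractingD(3)[OF K compact_sing[of undefined] zero_less_one] this]
    obtain t N where N: "N \<in> sets P" "prob N \<le> 0 + \<eta>"
      "{\<omega>. \<exists>x\<in>\<phi> t (\<theta> (- t) \<omega>) ` {undefined}. ennreal 1 < pt_dist x (K \<omega>)} \<inter> space P \<subseteq> N"
      by (auto simp: eventually_at_top_linorder)
    have "E \<subseteq> N"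
      using N(3) by (auto simp: E_def pt_dist_infdist split: if_splits)
    then have "prob E \<le> prob N" using N(1) by (rule finite_measure_mono)
    with N show "prob E \<le> 0 + \<eta>" by simp
  qed
  then have "prob E = 0" using measure_nonneg[of P E] by linarith
  then have "AE \<omega> in P. \<omega> \<notin> E"
    using E by (simp add: AE_iff_measurable[of E] emeasure_eq_measure AE_not_in null_setsI)
  then show ?thesis
    using AE_space by eventually_elim (auto simp: E_def pt_dist_infdist)
qed

text \<open>For \<open>t \<ge> 0\<close> the events are measurable, and for measurable events the
  outer bound 0 is convergence of the probabilities to 0.\<close>

lemma weakly_attracts_iff_outer_limsup:
  assumes K: "compact_random_set P K"
  shows "weakly_attracts P \<theta> \<phi> K B \<longleftrightarrow> (\<forall>\<delta>>0.
    outer_limsup_le P (\<lambda>t. {\<omega>. \<exists>x\<in>\<phi> t (\<theta> (- t) \<omega>) ` B. ennreal \<delta> < pt_dist x (K \<omega>)}) 0)"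
proof -
  define E where "E \<delta> t = {\<omega>\<in>space P. semi_dist (\<phi> t (\<theta> (- t) \<omega>) ` B) (K \<omega>) > ennreal \<delta>}" for \<delta> t
  have eq: "E \<delta> t = {\<omega>. \<exists>x\<in>\<phi> t (\<theta> (- t) \<omega>) ` B. ennreal \<delta> < pt_dist x (K \<omega>)} \<inter> space P" for \<delta> t
    by (auto simp: E_def semi_dist_def less_SUP_iff)
  have "E \<delta> t \<in> sets P" if "0 \<le> t" for \<delta> t
  proof -
    have "(\<lambda>\<omega>. SUP x\<in>B. pt_dist (\<phi> t (\<theta> (- t) \<omega>) x) (K (\<theta> 0 \<omega>))) \<in> borel_measurable P"
      by (rule measurable_SUP_pt_dist_flow[OF K that])
    then have [measurable]: "(\<lambda>\<omega>. semi_dist (\<phi> t (\<theta> (- t) \<omega>) ` B) (K \<omega>)) \<in> borel_measurable P"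
      by (rule measurable_cong[THEN iffD1, rotated]) (simp add: semi_dist_def image_image shift_zero)
    show ?thesis unfolding E_def by measurable
  qed
  then have "outer_limsup_le P (E \<delta>) 0 \<longleftrightarrow> ((\<lambda>t. prob (E \<delta> t)) \<longlongrightarrow> 0) at_top" for \<delta>
    by (intro outer_limsup_le_0_iff_tendsto eventually_at_top_linorderI[of 0])
  moreover have "outer_limsup_le P (E \<delta>) 0 \<longleftrightarrow>
    outer_limsup_le P (\<lambda>t. {\<omega>. \<exists>x\<in>\<phi> t (\<theta> (- t) \<omega>) ` B. ennreal \<delta> < pt_dist x (K \<omega>)}) 0" for \<delta>
    unfolding outer_limsup_le_def eq by (simp add: Int_assoc)
  ultimately show ?thesis
    unfolding weakly_attracts_def tendsto_zero_in_prob_def E_def by simp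
qed

lemma attracting_iff_weakly_attracts:
  "attracting K \<longleftrightarrow> compact_random_set P K \<and> (\<forall>B. compact B \<longrightarrow> weakly_attracts P \<theta> \<phi> K B)"
proof
  assume K: "attracting K"
  then have "compact_random_set P K"
    using attracting_AE_nonempty by (simp add: compact_random_set_def attracting_def)
  with K show "compact_random_set P K \<and> (\<forall>B. compact B \<longrightarrow> weakly_attracts P \<theta> \<phi> K B)"
    by (simp add: weakly_attracts_iff_outer_limsup attracting_def)
next
  assume "compact_random_set P K \<and> (\<forall>B. compact B \<longrightarrow> weakly_attracts P \<theta> \<phi> K B)"
  then show "attracting K"
    using weakly_attracts_iff_outer_limsup[of K]
    by (simp add: attracting_def compact_random_set_def)
qed

text \<open>For each fixed \<open>t \<ge> 0\<close> the pullback event is the preimage of the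
  forward event under \<open>\<theta> (- t)\<close>, so the probabilities coincide.\<close>

lemma weakly_attracts_iff_forward:
  assumes A: "compact_random_set P A"
  shows "weakly_attracts P \<theta> \<phi> A B \<longleftrightarrow>
    tendsto_zero_in_prob P (\<lambda>t \<omega>. SUP x\<in>B. pt_dist (\<phi> t \<omega> x) (A (\<theta> t \<omega>)))"
proof -
  have "\<P>(\<omega> in P. semi_dist (\<phi> t (\<theta> (- t) \<omega>) ` B) (A \<omega>) > ennreal \<epsilon>) =
      \<P>(\<omega> in P. (SUP x\<in>B. pt_dist (\<phi> t \<omega> x) (A (\<theta> t \<omega>))) > ennreal \<epsilon>)" (is "_ = prob ?F")
    if "0 \<le> t" for t \<epsilon>
  proof -
    have "(\<lambda>\<omega>. SUP x\<in>B. pt_dist (\<phi> t (\<theta> 0 \<omega>) x) (A (\<theta> t \<omega>))) \<in> borel_measurable P"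
      by (rule measurable_SUP_pt_dist_flow[OF A that])
    then have [measurable]: "(\<lambda>\<omega>. SUP x\<in>B. pt_dist (\<phi> t \<omega> x) (A (\<theta> t \<omega>))) \<in> borel_measurable P"
      by (rule measurable_cong[THEN iffD1, rotated]) (simp add: shift_zero)
    have "?F \<in> sets P" by measurable
    from prob_shift_vimage[OF this, of "- t"] show ?thesis
    proof (rule back_subst[where P = "\<lambda>E. prob E = prob ?F"])
      show "\<theta> (- t) -` ?F \<inter> space P =
          {\<omega>\<in>space P. semi_dist (\<phi> t (\<theta> (- t) \<omega>) ` B) (A \<omega>) > ennreal \<epsilon>}"
        using shift_in_space by (auto simp: semi_dist_def image_image shift_inverse)
    qed
  qed
  then show ?thesis
    unfolding weakly_attracts_def tendsto_zero_in_prob_def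
    by (intro all_cong imp_cong refl filterlim_cong eventually_at_top_linorderI[of 0])
qed

lemma weak_C_attractor_of_attracting:
  assumes "attracting K"
  shows "\<exists>A. weak_C_attractor P \<theta> \<phi> A"
proof -
  obtain A where A: "attracting A" "\<And>K. attracting K \<Longrightarrow> AE \<omega> in P. A \<omega> \<subseteq> K \<omega>"
    using attracting_minimal[OF assms] by blast
  have "AE \<omega> in P. \<phi> t \<omega> ` A \<omega> = A (\<theta> t \<omega>)" if t: "0 \<le> t" for t
  proof -
    \<comment> \<open>Minimality against the image is a statement over the end point; evaluated at
      \<open>\<theta> t \<omega>\<close> it puts \<open>A (\<theta> t \<omega>)\<close> inside the
      image of \<open>A \<omega>\<close>. Minimality against the preimage set gives the converse
      inclusion.\<close>
    have "AE \<omega> in P. A (\<theta> t \<omega>) \<subseteq> \<phi> t (\<theta> (- t) (\<theta> t \<omega>)) ` A (\<theta> (- t) (\<theta> t \<omega>))"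
      by (rule AE_shift[OF A(2)[OF attracting_image[OF A(1) t]]])
    moreover have "AE \<omega> in P. A \<omega> \<subseteq> {x \<in> A \<omega>. \<phi> t \<omega> x \<in> A (\<theta> t \<omega>)}"
      by (rule A(2)[OF attracting_Int_preimage[OF A(1) t]])
    ultimately show ?thesis
      using AE_space
    proof eventually_elim
      case (elim \<omega>)
      with shift_inverse(2)[OF elim(3)] show ?case by auto
    qed
  qed
  then have "weak_C_attractor P \<theta> \<phi> A"
    using A(1) weakly_attracts_iff_forward[of A]
    by (auto simp: weak_C_attractor_def strictly_invariant_def attracting_iff_weakly_attracts)
  then show ?thesis by blast
qed

lemma attracting_of_weak_C_attractor: "weak_C_attractor P \<theta> \<phi> A \<Longrightarrow> attracting A"
  using weakly_attracts_iff_forward[of A]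
  by (auto simp: weak_C_attractor_def attracting_iff_weakly_attracts)

end

section \<open>Tightness of random compact sets\<close>

text \<open>As in Ulam's theorem: at each scale \<open>1 / Suc k\<close>, finitely many of the
  points \<open>q n\<close> suffice outside an event of probability at most
  \<open>\<epsilon> * (1 / 2) ^ Suc k\<close>. The points that satisfy the bounds at all scales form
  a closed, totally bounded set, compact by completeness of the state space.\<close>

lemma (in prob_space) random_compact_set_tight:
  fixes K :: "'a \<Rightarrow> 'e::polish_space set"
  assumes K: "\<And>\<omega>. \<omega> \<in> space M \<Longrightarrow> compact (K \<omega>)"
      "\<And>x. (\<lambda>\<omega>. pt_dist x (K \<omega>)) \<in> borel_measurable M"
    and \<epsilon>: "0 < \<epsilon>"
  obtains C T where "compact C" "T \<in> sets M" "1 - \<epsilon> \<le> prob T" "\<And>\<omega>. \<omega> \<in> T \<Longrightarrow> K \<omega> \<subseteq> C"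
proof -
  obtain D :: "'e set" where D: "countable D" "\<And>X. open X \<Longrightarrow> X \<noteq> {} \<Longrightarrow> \<exists>d\<in>D. d \<in> X"
    using countable_dense_exists by blast
  obtain q :: "nat \<Rightarrow> 'e" where q: "\<And>x e. 0 < e \<Longrightarrow> \<exists>k. dist x (q k) < e"
    using dense_sequence by metis
  \<comment> \<open>Only points of \<open>D\<close> near \<open>K \<omega>\<close> are tested, for
    measurability. Such a point is within \<open>1 / Suc k\<close> of \<open>K \<omega>\<close>, and
    the covering adds another \<open>1 / Suc k\<close>, whence the tolerance
    \<open>2 / Suc k\<close>.\<close>
  define N where "N k m = {\<omega>\<in>space M. \<forall>d\<in>D.
      pt_dist d (K \<omega>) < ennreal (1 / Suc k) \<longrightarrow> pt_dist d (q ` {..m}) \<le> ennreal (2 / Suc k)}" for k m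
  note [measurable] = K(2)
  have N_sets: "N k m \<in> sets M" for k m
    unfolding N_def by (intro sets.sets_Collect_countable_All'[OF _ D(1)]) measurable
  have N_mono: "incseq (N k)" for k
  proof (intro incseq_SucI subsetI)
    fix m \<omega> assume "\<omega> \<in> N k m"
    moreover have "pt_dist d (q ` {..Suc m}) \<le> pt_dist d (q ` {..m})" for d
      by (intro pt_dist_antimono image_mono) auto
    ultimately show "\<omega> \<in> N k (Suc m)"
      unfolding N_def by (blast intro: order_trans)
  qed
  have N_Un: "(\<Union>m. N k m) = space M" for k
  proof
    show "space M \<subseteq> (\<Union>m. N k m)"
    proof
      fix \<omega> assume \<omega>: "\<omega> \<in> space M"
      have "K \<omega> \<subseteq> (\<Union>n. ball (q n) (1 / Suc k))"
        using q[of "1 / Suc k"] by (auto simp: dist_commute)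
      then obtain J where J: "finite J" "K \<omega> \<subseteq> (\<Union>n\<in>J. ball (q n) (1 / Suc k))"
        using compactE_image[OF K(1)[OF \<omega>], of UNIV "\<lambda>n. ball (q n) (1 / Suc k)"] by auto
      obtain m where m: "J \<subseteq> {..m}" using J(1) by (meson finite_nat_iff_bounded_le)
      have "pt_dist d (q ` {..m}) \<le> ennreal (2 / Suc k)"
        if near: "pt_dist d (K \<omega>) < ennreal (1 / Suc k)" for d
      proof -
        obtain a where a: "a \<in> K \<omega>" "dist d a < 1 / Suc k"
          using near by (rule pt_dist_lessD)
        then obtain n where n: "n \<in> J" "dist (q n) a < 1 / Suc k" using J(2) by auto
        have "pt_dist d (q ` {..m}) \<le> ennreal (dist d (q n))"
          unfolding pt_dist_def using n(1) m by (intro INF_lower) auto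
        also have "\<dots> \<le> ennreal (2 / Suc k)"
        proof (rule ennreal_leI)
          have "dist d (q n) \<le> 1 / Suc k + 1 / Suc k"
            using a(2) n(2) dist_triangle2[of d "q n" a] by linarith
          then show "dist d (q n) \<le> 2 / Suc k" by simp
        qed
        finally show ?thesis .
      qed
      with \<omega> show "\<omega> \<in> (\<Union>m. N k m)" by (auto simp: N_def)
    qed
  qed (auto simp: N_def)
  have "\<exists>m. prob (space M - N k m) \<le> \<epsilon> * (1 / 2) ^ Suc k" for k
  proof -
    have "(\<lambda>m. prob (N k m)) \<longlonglongrightarrow> prob (\<Union>m. N k m)"
      using N_sets by (intro finite_Lim_measure_incseq N_mono) auto
    then have "(\<lambda>m. prob (N k m)) \<longlonglongrightarrow> 1"
      by (simp add: N_Un prob_space)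
    then have "\<forall>\<^sub>F m in sequentially. 1 - \<epsilon> * (1 / 2) ^ Suc k < prob (N k m)"
      using \<epsilon> by (intro order_tendstoD) auto
    then obtain m where "1 - \<epsilon> * (1 / 2) ^ Suc k < prob (N k m)"
      by (auto simp: eventually_sequentially)
    then show ?thesis using N_sets by (intro exI[of _ m]) (simp add: prob_compl)
  qed
  then obtain m where m: "\<And>k. prob (space M - N k (m k)) \<le> \<epsilon> * (1 / 2) ^ Suc k" by metis
  define T where "T = (\<Inter>k. N k (m k))"
  define C where "C = (\<Inter>k. {x. pt_dist x (q ` {..m k}) \<le> ennreal (2 / Suc k)})"
  have T_sets: "T \<in> sets M" unfolding T_def using N_sets by (intro sets.countable_INT) auto
  have sums: "(\<lambda>k. \<epsilon> * (1 / 2) ^ Suc k) sums \<epsilon>"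
    using sums_mult[OF power_half_series, of \<epsilon>] by simp
  have summable: "summable (\<lambda>k. prob (space M - N k (m k)))"
    by (rule summable_comparison_test'[OF sums_summable[OF sums], of 0]) (use m in auto)
  have "prob (\<Union>k. space M - N k (m k)) \<le> (\<Sum>k. prob (space M - N k (m k)))"
    using N_sets by (intro finite_measure_subadditive_countably summable) auto
  also have "\<dots> \<le> (\<Sum>k. \<epsilon> * (1 / 2) ^ Suc k)"
    by (intro suminf_le m summable sums_summable[OF sums])
  also have "\<dots> = \<epsilon>" by (rule sums_unique[OF sums, symmetric])
  also have "(\<Union>k. space M - N k (m k)) = space M - T" by (auto simp: T_def)
  finally have "1 - \<epsilon> \<le> prob T" using prob_compl[OF T_sets] by simp
  moreover have "closed C"
    unfolding C_def by (intro closed_INT ballI closed_Collect_le continuous_pt_dist continuous_on_const)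
  then have "compact C"
    unfolding compact_eq_totally_bounded complete_eq_closed
  proof (intro conjI allI impI)
    fix e :: real assume "0 < e"
    then obtain k where k: "2 / e < real k" using reals_Archimedean2 by blast
    then have k': "2 / Suc k < e"
      using \<open>0 < e\<close> by (simp add: field_simps)
    show "\<exists>F. finite F \<and> C \<subseteq> (\<Union>x\<in>F. ball x e)"
    proof (intro exI conjI subsetI)
      fix x assume "x \<in> C"
      then have "pt_dist x (q ` {..m k}) \<le> ennreal (2 / Suc k)" by (auto simp: C_def)
      also have "\<dots> < ennreal e" using k' by (intro ennreal_lessI \<open>0 < e\<close>)
      finally obtain a where "a \<in> q ` {..m k}" "dist x a < e" by (rule pt_dist_lessD)
      then show "x \<in> (\<Union>x\<in>q ` {..m k}. ball x e)" by (auto simp: dist_commute)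
    qed simp
  qed
  moreover have "K \<omega> \<subseteq> C" if \<omega>: "\<omega> \<in> T" for \<omega>
  proof (rule subsetI, rule ccontr)
    fix x assume x: "x \<in> K \<omega>" "x \<notin> C"
    then obtain k where k: "ennreal (2 / Suc k) < pt_dist x (q ` {..m k})"
      by (auto simp: C_def not_le)
    \<comment> \<open>If \<open>x\<close> violates the bound at scale \<open>k\<close>, so does a
      nearby point of \<open>D\<close>, close enough to \<open>K \<omega>\<close> to be tested by
      \<open>N k (m k)\<close>.\<close>
    have "open ({y. ennreal (2 / Suc k) < pt_dist y (q ` {..m k})} \<inter> ball x (1 / Suc k))"
      by (intro open_Int open_Collect_less continuous_pt_dist continuous_on_const open_ball)
    moreover have "x \<in> {y. ennreal (2 / Suc k) < pt_dist y (q ` {..m k})} \<inter> ball x (1 / Suc k)"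
      using k by simp
    ultimately obtain d where d: "d \<in> D" "ennreal (2 / Suc k) < pt_dist d (q ` {..m k})"
      "d \<in> ball x (1 / Suc k)" using D(2) by blast
    have "pt_dist d (K \<omega>) \<le> ennreal (dist d x)"
      unfolding pt_dist_def using x(1) by (rule INF_lower)
    also have "\<dots> < ennreal (1 / Suc k)"
      using d(3) by (intro ennreal_lessI) (auto simp: dist_commute)
    finally have "pt_dist d (K \<omega>) < ennreal (1 / Suc k)" .
    moreover have "\<omega> \<in> N k (m k)" using \<omega> by (auto simp: T_def)
    ultimately show False using d(1,2) by (auto simp: N_def)
  qed
  ultimately show thesis using T_sets that by blast
qed

section \<open>Absorption in probability by deterministic compact sets\<close>

context continuous_random_dynamical_system
begin

text \<open>Condition (ii) asks for such a \<open>C\<close> for every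
  \<open>\<epsilon> > 0\<close>.\<close>

definition absorbs :: "real \<Rightarrow> 'e set \<Rightarrow> bool" where
  "absorbs \<epsilon> C \<longleftrightarrow> compact C \<and> (\<forall>\<delta>>0. \<forall>B. compact B \<longrightarrow>
    (\<exists>t\<^sub>0>0. \<forall>t\<ge>t\<^sub>0. \<P>(\<omega> in P. \<phi> t \<omega> ` B \<subseteq> closed_nbhd C \<delta>) \<ge> 1 - \<epsilon>))"

text \<open>Half of \<open>\<epsilon>\<close> pays for \<open>K \<omega>\<close> leaving a fixed
  compact set, the other half for the failure of attraction. Invariance of \<open>P\<close> moves
  the resulting event \<open>T - N\<close> to forward time.\<close>

lemma absorbs_of_attracting:
  assumes K: "attracting K" and \<epsilon>: "0 < \<epsilon>"
  shows "\<exists>C. absorbs \<epsilon> C"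
proof -
  have "0 < \<epsilon> / 2" using \<epsilon> by simp
  from random_compact_set_tight[OF attractingD(1,2)[OF K] this]
  obtain C T where C: "compact C" "T \<in> sets P" "1 - \<epsilon> / 2 \<le> prob T" "\<And>\<omega>. \<omega> \<in> T \<Longrightarrow> K \<omega> \<subseteq> C" by metis
  have "\<exists>t\<^sub>0>0. \<forall>t\<ge>t\<^sub>0. \<P>(\<omega> in P. \<phi> t \<omega> ` B \<subseteq> closed_nbhd C \<delta>) \<ge> 1 - \<epsilon>"
    if \<delta>: "0 < \<delta>" and B: "compact B" for \<delta> B
  proof -
    from outer_limsup_leD[OF attractingD(3)[OF K B \<delta>] \<open>0 < \<epsilon> / 2\<close>]
    obtain t\<^sub>0 where t\<^sub>0: "\<And>t. t\<^sub>0 \<le> t \<Longrightarrow> \<exists>N\<in>sets P.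
        {\<omega>. \<exists>x\<in>\<phi> t (\<theta> (- t) \<omega>) ` B. ennreal \<delta> < pt_dist x (K \<omega>)} \<inter> space P \<subseteq> N \<and> prob N \<le> 0 + \<epsilon> / 2"
      by (auto simp: eventually_at_top_linorder)
    have "\<P>(\<omega> in P. \<phi> t \<omega> ` B \<subseteq> closed_nbhd C \<delta>) \<ge> 1 - \<epsilon>" if t: "max t\<^sub>0 1 \<le> t" for t
    proof -
      obtain N where N: "N \<in> sets P" "prob N \<le> \<epsilon> / 2"
        "{\<omega>. \<exists>x\<in>\<phi> t (\<theta> (- t) \<omega>) ` B. ennreal \<delta> < pt_dist x (K \<omega>)} \<inter> space P \<subseteq> N"
        using t\<^sub>0[of t] t by auto
      have "prob T \<le> prob (T - N) + prob N"
        using measure_Un_le[of "T - N" P N] C(2) N(1)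
          finite_measure_mono[of T "(T - N) \<union> N"] by auto
      then have "1 - \<epsilon> \<le> prob (T - N)" using C(3) N(2) by simp
      also have "\<dots> = prob (\<theta> t -` (T - N) \<inter> space P)"
        using C(2) N(1) by (intro prob_shift_vimage[symmetric]) auto
      also have "\<dots> \<le> \<P>(\<omega> in P. \<phi> t \<omega> ` B \<subseteq> closed_nbhd C \<delta>)"
      proof (rule finite_measure_mono[OF subsetI sets_flow_subset_closed_nbhd])
        show "0 \<le> t" using t by simp
        fix \<omega> assume \<omega>: "\<omega> \<in> \<theta> t -` (T - N) \<inter> space P"
        then have shift_back: "\<theta> (- t) (\<theta> t \<omega>) = \<omega>"
          using shift_inverse(2) by blast
        have "\<phi> t \<omega> x \<in> closed_nbhd C \<delta>" if "x \<in> B" for x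
        proof -
          have "pt_dist (\<phi> t \<omega> x) C \<le> pt_dist (\<phi> t \<omega> x) (K (\<theta> t \<omega>))"
            using C(4) \<omega> by (intro pt_dist_antimono) auto
          also have "\<dots> \<le> ennreal \<delta>"
            using \<omega> N(3) shift_in_space[of \<omega> t] shift_back that by (force simp: not_less[symmetric])
          finally show ?thesis by (simp add: closed_nbhd_def)
        qed
        with \<omega> show "\<omega> \<in> {\<omega>\<in>space P. \<phi> t \<omega> ` B \<subseteq> closed_nbhd C \<delta>}" by auto
      qed
      finally show ?thesis .
    qed
    then show ?thesis by (intro exI[of _ "max t\<^sub>0 1"]) auto
  qed
  with C(1) show ?thesis unfolding absorbs_def by blast
qed

lemma attracting_of_absorbs:
  assumes absorbs: "\<And>\<epsilon>. 0 < \<epsilon> \<Longrightarrow> \<exists>C. absorbs \<epsilon> C"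
  shows "\<exists>K. attracting K"
proof -
  have "\<forall>n. \<exists>C. absorbs ((1 / 2) ^ n) C" by (simp add: absorbs)
  then obtain C where absorbs_C: "\<And>n. absorbs ((1 / 2) ^ n) (C n)" by metis
  have C: "compact (C n)" "0 < \<delta> \<Longrightarrow> compact B \<Longrightarrow>
    \<exists>t\<^sub>0>0. \<forall>t\<ge>t\<^sub>0. \<P>(\<omega> in P. \<phi> t \<omega> ` B \<subseteq> closed_nbhd (C n) \<delta>) \<ge> 1 - (1 / 2) ^ n" for n \<delta> B
    using absorbs_C[of n] unfolding absorbs_def by blast+

  \<comment> \<open>The absorption property in pullback form, with the allowed failure probability
    as the bound.\<close>
  have approx: "outer_limsup_le P
      (\<lambda>t. {\<omega>. \<exists>x\<in>\<phi> t (\<theta> (- t) \<omega>) ` B. ennreal \<delta> < pt_dist x (C n)}) ((1 / 2) ^ n)"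
    if B: "compact B" "0 < \<delta>" for n B \<delta>
  proof -
    define F where "F t = space P - {\<omega>\<in>space P. \<phi> t \<omega> ` B \<subseteq> closed_nbhd (C n) \<delta>}" for t
    obtain t\<^sub>0 where t\<^sub>0: "t\<^sub>0 > 0"
      "\<And>t. t\<^sub>0 \<le> t \<Longrightarrow> \<P>(\<omega> in P. \<phi> t \<omega> ` B \<subseteq> closed_nbhd (C n) \<delta>) \<ge> 1 - (1 / 2) ^ n"
      using C(2)[OF B(2,1)] by blast
    have "F t \<in> sets P \<and> prob (F t) \<le> (1 / 2) ^ n" if "t\<^sub>0 \<le> t" for t
      using t\<^sub>0(1) t\<^sub>0(2)[OF that] sets_flow_subset_closed_nbhd[of t B "C n" \<delta>] that
      unfolding F_def by (subst prob_compl) auto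
    then have "outer_limsup_le P F ((1 / 2) ^ n)"
      by (intro outer_limsup_le_measurable eventually_at_top_linorderI)
    from outer_limsup_le_shift[OF this, of uminus] show ?thesis
      by (rule outer_limsup_le_mono)
        (auto simp: F_def closed_nbhd_def shift_in_space not_le[symmetric] image_subset_iff intro!: always_eventually)
  qed

  \<comment> \<open>The sets \<open>C m\<close> themselves are the test sets, with tolerance
    \<open>1 / Suc m\<close> tending to 0. The waiting time \<open>\<tau> n m\<close> chosen next
    stays fixed from then on.\<close>
  define R where "R n m t = {\<omega>\<in>space P. \<phi> t \<omega> ` C m \<subseteq> closed_nbhd (C n) (1 / Suc m)}" for n m t
  have "\<exists>t. 0 \<le> t \<and> 1 - (1 / 2) ^ n \<le> prob (R n m t)" for n m
  proof -
    have "0 < 1 / real (Suc m)" by simp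
    from C(2)[OF this C(1)[of m], of n] show ?thesis
      unfolding R_def by (meson less_imp_le order_refl)
  qed
  then obtain \<tau> where \<tau>: "\<And>n m. 0 \<le> \<tau> n m" "\<And>n m. 1 - (1 / 2) ^ n \<le> prob (R n m (\<tau> n m))"
    by metis
  define W' where "W' n m = R n m (\<tau> n m)" for n m
  define W where "W n m = \<theta> (- \<tau> n m) -` W' n m \<inter> space P" for n m
  have W'_sets: "W' n m \<in> sets P" for n m
    unfolding W'_def R_def by (rule sets_flow_subset_closed_nbhd[OF \<tau>(1)])
  have W_sets: "W n m \<in> sets P" for n m
    unfolding W_def using W'_sets by (rule measurable_sets[OF measurable_shift_time])
  have W_prob: "1 - (1 / 2) ^ n \<le> prob (W n m)" for n m
    unfolding W_def prob_shift_vimage[OF W'_sets] using \<tau>(2)[of n m] by (simp add: W'_def)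
  \<comment> \<open>On \<open>W n m\<close> the loss \<open>(1 / 2) ^ n\<close> has already been
    paid, so only the failure \<open>(1 / 2) ^ m\<close> of approaching \<open>C m\<close> remains.
    The threshold \<open>2 / Suc m\<close> leaves the room above \<open>1 / Suc m\<close> that a
    strict bound requires.\<close>
  have outer_W: "outer_limsup_le P
      (\<lambda>s. {\<omega>\<in>W n m. \<exists>x\<in>\<phi> s (\<theta> (- s) \<omega>) ` B. ennreal (2 / Suc m) < pt_dist x (C n)}) ((1 / 2) ^ m)"
    if B: "compact B" for n m B
  proof -
    have "outer_limsup_le P (\<lambda>s. {\<omega>\<in>W' n m. \<exists>x\<in>\<phi> s (\<theta> (- s) \<omega>) ` B.
        ennreal (2 / Suc m) < pt_dist (\<phi> (\<tau> n m) \<omega> x) (C n)}) ((1 / 2) ^ m)"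
    proof (rule outer_limsup_le_transfer[where K = "\<lambda>_. C m" and G = "\<lambda>i \<omega> x. pt_dist x (C m)"])
      show "pt_dist (\<phi> (\<tau> n m) \<omega> x) (C n) < ennreal (2 / Suc m)"
        if "\<omega> \<in> W' n m" "\<And>i::nat. pt_dist x (C m) = 0" for \<omega> x
      proof -
        have "x \<in> C m"
          using pt_dist_eq_0_iff[OF compact_imp_closed[OF C(1)]] that(2) by simp
        with that(1) have "pt_dist (\<phi> (\<tau> n m) \<omega> x) (C n) \<le> ennreal (1 / Suc m)"
          by (auto simp: W'_def R_def closed_nbhd_def)
        also have "\<dots> < ennreal (2 / Suc m)"
          by (intro ennreal_lessI divide_strict_right_mono) auto
        finally show ?thesis .
      qed
      show "continuous_on UNIV (\<lambda>x. pt_dist (\<phi> (\<tau> n m) \<omega> x) (C n))" if "\<omega> \<in> W' n m" for \<omega>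
        using that \<tau>(1)
        by (intro continuous_on_compose2[OF continuous_pt_dist continuous_flow]) (auto simp: W'_def R_def)
      show "(\<lambda>\<omega>. pt_dist (\<phi> (\<tau> n m) \<omega> x) (C n)) \<in> borel_measurable P" for x
        by (rule measurable_pt_dist_random_set[OF _ measurable_flow_point[OF \<tau>(1)]]) simp
      show "outer_limsup_le P (\<lambda>s. {\<omega>. \<exists>x\<in>\<phi> s (\<theta> (- s) \<omega>) ` B. \<exists>i\<le>k.
          ennreal \<delta> < pt_dist x (C m)}) ((1 / 2) ^ m)" if "0 < \<delta>" for k :: nat and \<delta>
        by (rule outer_limsup_le_mono[OF approx[OF B that] order_refl])
          (auto intro!: always_eventually)
    qed (use C(1) W'_sets continuous_pt_dist in auto)
    from outer_limsup_le_push[where g = "\<lambda>_ x. pt_dist x (C n)", OF this \<tau>(1)] show ?thesis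
      by (rule outer_limsup_le_mono) (auto simp: W_def intro!: always_eventually)
  qed

  define U where "U n j = (\<Union>m\<in>{j..}. W n m)" for n j
  define V where "V n = (\<Inter>j. U n j)" for n
  have U_sets: "U n j \<in> sets P" for n j unfolding U_def using W_sets by auto
  have V_sets: "V n \<in> sets P" for n unfolding V_def using U_sets by auto
  \<comment> \<open>Each tail union contains some \<open>W n m\<close>, so the lower bound survives
    the decreasing limit.\<close>
  have V_prob: "1 - (1 / 2) ^ n \<le> prob (V n)" for n
  proof -
    have "decseq (U n)" unfolding decseq_def U_def by (intro allI impI UN_mono) auto
    then have "(\<lambda>j. prob (U n j)) \<longlonglongrightarrow> prob (V n)"
      unfolding V_def using U_sets by (intro finite_Lim_measure_decseq) auto
    moreover have "1 - (1 / 2) ^ n \<le> prob (U n j)" for j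
      using W_prob[of n j] U_sets finite_measure_mono[of "W n j" "U n j"]
      by (force simp: U_def)
    ultimately show ?thesis by (intro LIMSEQ_le_const) auto
  qed
  \<comment> \<open>The errors \<open>(1 / 2) ^ m\<close> with \<open>m \<ge> j\<close> sum to at
    most \<open>2 * (1 / 2) ^ j\<close>, and the thresholds \<open>2 / Suc m\<close> fall below
    \<open>\<delta>\<close>. As \<open>V n\<close> lies in every tail \<open>U n j\<close>, a late
    tail gives an arbitrarily small bound.\<close>
  have outer_V: "outer_limsup_le P
      (\<lambda>s. {\<omega>\<in>V n. \<exists>x\<in>\<phi> s (\<theta> (- s) \<omega>) ` B. ennreal \<delta> < pt_dist x (C n)}) 0"
    if B: "compact B" and \<delta>: "0 < \<delta>" for n B \<delta>
  proof (rule outer_limsup_le_approx)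
    fix \<eta> :: real assume \<eta>: "0 < \<eta>"
    have lim: "(\<lambda>j. 2 / real (Suc j)) \<longlonglongrightarrow> 0"
      using tendsto_mult_right_zero[OF LIMSEQ_inverse_real_of_nat, of 2] by (simp add: divide_inverse)
    have lim': "(\<lambda>j. 2 * (1 / 2) ^ j :: real) \<longlonglongrightarrow> 0"
      by (intro tendsto_mult_right_zero LIMSEQ_realpow_zero) auto
    have "0 < \<eta> / 2" using \<eta> by simp
    from eventually_conj[OF order_tendstoD(2)[OF lim \<delta>] order_tendstoD(2)[OF lim' this]]
    obtain j where j: "2 / real (Suc j) < \<delta>" "2 * (1 / 2) ^ j < \<eta> / 2"
      by (auto simp: eventually_sequentially)
    \<comment> \<open>Bounds are added only over finite unions, so the tail is cut to finitely many
      \<open>m\<close> at a cost below \<open>\<eta> / 2\<close>.\<close>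
    define UJ where "UJ k = (\<Union>m\<in>{j..<j + k}. W n m)" for k
    have UJ_sets: "UJ k \<in> sets P" for k unfolding UJ_def using W_sets by auto
    have "(\<Union>k. UJ k) = U n j"
    proof
      show "U n j \<subseteq> (\<Union>k. UJ k)"
      proof
        fix \<omega> assume "\<omega> \<in> U n j"
        then obtain m where "j \<le> m" "\<omega> \<in> W n m" by (auto simp: U_def)
        then have "\<omega> \<in> UJ (Suc m)" by (auto simp: UJ_def)
        then show "\<omega> \<in> (\<Union>k. UJ k)" by blast
      qed
    qed (auto simp: UJ_def U_def)
    moreover have "incseq UJ" unfolding incseq_def UJ_def by (intro allI impI UN_mono) auto
    ultimately have "(\<lambda>k. prob (UJ k)) \<longlonglongrightarrow> prob (U n j)"
      using UJ_sets finite_Lim_measure_incseq[of UJ] by auto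
    then have "\<forall>\<^sub>F k in sequentially. prob (U n j) - \<eta> / 2 < prob (UJ k)"
      using \<eta> by (intro order_tendstoD) auto
    then obtain k where k: "prob (U n j) - \<eta> / 2 < prob (UJ k)"
      by (auto simp: eventually_sequentially)
    have "UJ k \<subseteq> U n j" by (auto simp: UJ_def U_def)
    then have diff: "prob (U n j - UJ k) < \<eta> / 2"
      using k U_sets UJ_sets by (subst finite_measure_Diff) auto
    have "(\<Sum>m\<in>{j..<j + k}. (1 / 2) ^ m) = 2 * (1 / 2) ^ j - 2 * (1 / 2 :: real) ^ (j + k)"
      by (induction k) auto
    also have "\<dots> \<le> 2 * (1 / 2) ^ j" by simp
    finally have sum: "(\<Sum>m\<in>{j..<j + k}. (1 / 2) ^ m) + prob (U n j - UJ k) \<le> 0 + \<eta>"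
      using diff j(2) by linarith
    have "outer_limsup_le P (\<lambda>s. (\<Union>m\<in>{j..<j + k}.
        {\<omega>\<in>W n m. \<exists>x\<in>\<phi> s (\<theta> (- s) \<omega>) ` B. ennreal (2 / Suc m) < pt_dist x (C n)}) \<union> (U n j - UJ k))
        ((\<Sum>m\<in>{j..<j + k}. (1 / 2) ^ m) + prob (U n j - UJ k))"
      using U_sets UJ_sets
      by (intro outer_limsup_le_Un outer_limsup_le_UN outer_limsup_le_const outer_W B) auto
    then show "outer_limsup_le P
      (\<lambda>s. {\<omega>\<in>V n. \<exists>x\<in>\<phi> s (\<theta> (- s) \<omega>) ` B. ennreal \<delta> < pt_dist x (C n)}) (0 + \<eta>)"
    proof (rule outer_limsup_le_mono[OF _ sum], intro always_eventually allI subsetI)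
      fix s \<omega>
      assume "\<omega> \<in> {\<omega>\<in>V n. \<exists>x\<in>\<phi> s (\<theta> (- s) \<omega>) ` B. ennreal \<delta> < pt_dist x (C n)} \<inter> space P"
      then obtain x where x: "\<omega> \<in> U n j" "x \<in> \<phi> s (\<theta> (- s) \<omega>) ` B" "ennreal \<delta> < pt_dist x (C n)"
        by (auto simp: V_def)
      have le: "ennreal (2 / Suc m) \<le> ennreal \<delta>" if "j \<le> m" for m
      proof (rule ennreal_leI)
        have "2 / real (Suc m) \<le> 2 / real (Suc j)" using that by (intro divide_left_mono) auto
        with j(1) show "2 / real (Suc m) \<le> \<delta>" by simp
      qed
      show "\<omega> \<in> (\<Union>m\<in>{j..<j + k}. {\<omega>\<in>W n m. \<exists>x\<in>\<phi> s (\<theta> (- s) \<omega>) ` B.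
          ennreal (2 / Suc m) < pt_dist x (C n)}) \<union> (U n j - UJ k)"
      proof (cases "\<omega> \<in> UJ k")
        case True
        then obtain m where m: "m \<in> {j..<j + k}" "\<omega> \<in> W n m" by (auto simp: UJ_def)
        then have "ennreal (2 / Suc m) < pt_dist x (C n)"
          using le_less_trans[OF le x(3)] by simp
        with m x(2) show ?thesis by blast
      qed (use x(1) in blast)
    qed
  qed

  \<comment> \<open>Where \<open>\<omega>\<close> lies in no \<open>V n\<close>, the least index is
    an unspecified number and \<open>K \<omega>\<close> is still one of the \<open>C n\<close>. Such
    points of the space fall into \<open>space P - V N\<close> for every \<open>N\<close>, hence
    into a null set.\<close>
  define K where "K \<omega> = C (LEAST n. \<omega> \<in> V n)" for \<omega>
  have "attracting K"
    unfolding attracting_def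
  proof (intro conjI allI impI ballI)
    show "compact (K \<omega>)" for \<omega> unfolding K_def by (rule C(1))
    note [measurable] = V_sets
    have "(\<lambda>\<omega>. LEAST n. \<omega> \<in> V n) \<in> P \<rightarrow>\<^sub>M count_space UNIV" by measurable
    then show "(\<lambda>\<omega>. pt_dist x (K \<omega>)) \<in> borel_measurable P" for x
      unfolding K_def by (rule measurable_compose) simp
    fix B :: "'e set" and \<delta> :: real assume B: "compact B" "0 < \<delta>"
    show "outer_limsup_le P (\<lambda>t. {\<omega>. \<exists>x\<in>\<phi> t (\<theta> (- t) \<omega>) ` B. ennreal \<delta> < pt_dist x (K \<omega>)}) 0"
    proof (rule outer_limsup_le_approx)
      fix \<eta> :: real assume "0 < \<eta>"
      \<comment> \<open>Off an event of probability below \<open>\<eta>\<close> the least index is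
        at most \<open>N\<close>, so only finitely many \<open>C n\<close> occur.\<close>
      then obtain N where "(1 / 2) ^ N < \<eta>"
        using real_arch_pow_inv[of \<eta> "1 / 2"] by auto
      then have le: "(\<Sum>n\<in>{..N}. 0) + prob (space P - V N) \<le> 0 + \<eta>"
        using V_prob[of N] prob_compl[OF V_sets, of N] by simp
      have "outer_limsup_le P (\<lambda>t. (\<Union>n\<in>{..N}.
          {\<omega>\<in>V n. \<exists>x\<in>\<phi> t (\<theta> (- t) \<omega>) ` B. ennreal \<delta> < pt_dist x (C n)}) \<union> (space P - V N))
          ((\<Sum>n\<in>{..N}. 0) + prob (space P - V N))"
        using V_sets by (intro outer_limsup_le_Un outer_limsup_le_UN outer_limsup_le_const outer_V B) auto
      then show "outer_limsup_le P
          (\<lambda>t. {\<omega>. \<exists>x\<in>\<phi> t (\<theta> (- t) \<omega>) ` B. ennreal \<delta> < pt_dist x (K \<omega>)}) (0 + \<eta>)"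
      proof (rule outer_limsup_le_mono[OF _ le], intro always_eventually allI subsetI)
        fix t \<omega>
        assume \<omega>: "\<omega> \<in> {\<omega>. \<exists>x\<in>\<phi> t (\<theta> (- t) \<omega>) ` B. ennreal \<delta> < pt_dist x (K \<omega>)} \<inter> space P"
        show "\<omega> \<in> (\<Union>n\<in>{..N}. {\<omega>\<in>V n. \<exists>x\<in>\<phi> t (\<theta> (- t) \<omega>) ` B. ennreal \<delta> < pt_dist x (C n)}) \<union>
            (space P - V N)"
        proof (cases "\<omega> \<in> V N")
          case True
          then have "\<omega> \<in> V (LEAST n. \<omega> \<in> V n)" "(LEAST n. \<omega> \<in> V n) \<le> N"
            by (rule LeastI, rule Least_le)
          with \<omega> show ?thesis unfolding K_def by blast
        qed (use \<omega> in blast)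
      qed
    qed
  qed
  then show ?thesis by blast
qed

end

section \<open>Equivalence of the three conditions\<close>

theorem theorem4p4:
  fixes P :: "'w measure" and \<theta> :: "real \<Rightarrow> 'w \<Rightarrow> 'w"
    and \<phi> :: "real \<Rightarrow> 'w \<Rightarrow> 'e::polish_space \<Rightarrow> 'e"
  assumes "continuous_random_dynamical_system P \<theta> \<phi>"
  shows "((\<exists>A. weak_C_attractor P \<theta> \<phi> A) \<longleftrightarrow>
          (\<forall>\<epsilon>>0. \<exists>C\<^sub>\<epsilon>. compact C\<^sub>\<epsilon> \<and>
             (\<forall>\<delta>>0. \<forall>C. compact C \<longrightarrow>
                (\<exists>t\<^sub>0>0. \<forall>t\<ge>t\<^sub>0. \<P>(\<omega> in P. \<phi> t \<omega> ` C \<subseteq> closed_nbhd C\<^sub>\<epsilon> \<delta>) \<ge> 1 - \<epsilon>)))) \<and>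
         ((\<forall>\<epsilon>>0. \<exists>C\<^sub>\<epsilon>. compact C\<^sub>\<epsilon> \<and>
             (\<forall>\<delta>>0. \<forall>C. compact C \<longrightarrow>
                (\<exists>t\<^sub>0>0. \<forall>t\<ge>t\<^sub>0. \<P>(\<omega> in P. \<phi> t \<omega> ` C \<subseteq> closed_nbhd C\<^sub>\<epsilon> \<delta>) \<ge> 1 - \<epsilon>))) \<longleftrightarrow>
          (\<exists>K. compact_random_set P K \<and> (\<forall>B. compact B \<longrightarrow> weakly_attracts P \<theta> \<phi> K B)))"
    (is "(?i \<longleftrightarrow> ?ii) \<and> (?ii \<longleftrightarrow> ?iii)")
proof -
  interpret continuous_random_dynamical_system P \<theta> \<phi> by (rule assms)
  \<comment> \<open>Each condition is compared with the existence of an attracting set.\<close>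
  have iii: "?iii \<longleftrightarrow> (\<exists>K. attracting K)"
    unfolding attracting_iff_weakly_attracts ..
  have i: "?i \<longleftrightarrow> (\<exists>K. attracting K)"
    using weak_C_attractor_of_attracting attracting_of_weak_C_attractor by blast
  have "?ii \<longleftrightarrow> (\<forall>\<epsilon>>0. \<exists>C. absorbs \<epsilon> C)"
    unfolding absorbs_def ..
  also have "\<dots> \<longleftrightarrow> (\<exists>K. attracting K)"
    by (metis absorbs_of_attracting attracting_of_absorbs)
  finally have ii: "?ii \<longleftrightarrow> (\<exists>K. attracting K)" .
  show ?thesis
    unfolding i ii iii by simp
qed

end
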